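(* Let $n>2$, let $L=B_{4n}$, or $L=C_{4n}$ with $n$ even, and let $\Gamma$ be the full (direction preserving) collineation group of the 3-net coordinatized by $L$. Then $\Gamma$ is the semidirect product $M\rtimes\mathrm{Aut}(L)$, where $M=T\Lambda\le\Gamma$ is the subgroup defined in the context, $\sigma\in\mathrm{Aut}(L)$ is identified with the collineation $(\sigma,\sigma)$, and the action of $\mathrm{Aut}(L)$ on $M$ is given by $(u,v)^\sigma=(u^\sigma,v^\sigma)$, where $u^\sigma=\sigma^{-1}u\sigma$.
   Context: Permutations act on the right, written $y^u$, and products are composed from left to right. For a loop $(L,\cdot)$ with unit $1$, $\lambda_x:y\mapsto xy$, $\rho_x:y\mapsto yx$, $S(L)=\{\lambda_x:x\in L\}$, $G(L)=\langle S(L)\rangle$, and $N_\lambda=\{m\in L: m\cdot xy=mx\cdot y\ \forall x,y\in L\}$ is the left nucleus. The loops: let $G_{8n}=\langle\alpha,\beta,\gamma:\alpha^{2n}=\beta^2=\gamma^2=(\alpha\beta)^2=1,\ \alpha\gamma=\gamma\alpha,\ \beta\gamma=\gamma\beta\rangle$ and, for $n$ even, $H_{8n}=\langle\alpha,\beta,\gamma:\alpha^{2n}=\beta^2=\gamma^2=(\alpha\beta)^2=1,\ \alpha\gamma=\gamma\alpha,\ \beta\gamma=\gamma\beta\alpha^n\rangle$. In each of these groups let $S=\{\alpha^{2i},\alpha^{2j+1}\beta,\alpha^k\beta\gamma: 1\le i,j\le n,\ 1\le k\le 2n\}$. The group acts faithfully on the $4n$ right cosets of $\langle\beta\rangle$,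 and $S$ acts sharply transitively. $B_{4n}$ (for $G_{8n}$), resp. $C_{4n}$ (for $H_{8n}$), is the loop on this coset set with unit $1=\langle\beta\rangle$ and multiplication $x\cdot y=y^{\lambda_x}$, where $\lambda_x$ is the unique element of $S$ mapping $1$ to $x$. These are left Bol loops ($x\cdot(y\cdot xz)=(x\cdot yx)\cdot z$) with $S(L)=S$ and $G(L)=G_{8n}$, resp. $H_{8n}$. The 3-net coordinatized by $L$ has point set $L\times L$, vertical lines $x=\text{const}$, horizontal lines $y=\text{const}$ and transversal lines $x\cdot y=\text{const}$. A direction preserving collineation is a bijection of the points mapping each of the three line classes to itself; it has the form $(x,y)\mapsto(x^u,y^v)$, denoted $(u,v)$, with permutations $u,v$ of $L$ for which there is a permutation $w$ with $x^u\cdot y^v=(x\cdot y)^w$ for all $x,y$. $\Gamma$ is the group of all of these. Let $p_x=\lambda_x^{-1}\rho_x^{-1}$, $N=\langle(p_x,\lambda_x):x\in L\rangle\le\Gamma$, and let $\Phi:N\to G(L)$ be the homomorphism $(u,v)\mapsto v$. Put $\Lambda_0=\langle\alpha,\gamma\rangle\le G(L)$, $\Lambda=\Phi^{-1}(\Lambda_0)$, $T=\{(\lambda_m,\mathrm{id}):m\in N_\lambda\}$ and $M=T\Lambda$. *)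

theory Defs
  imports "HOL-Algebra.Bij" "HOL-Algebra.Coset" "HOL-Algebra.Generated_Groups"
begin

subsection \<open>Groups given by generators and relations\<close>

datatype 'g letter = Gen 'g | Inv 'g

inductive rel_equiv :: "('g letter list \<times> 'g letter list) set \<Rightarrow>
    'g letter list \<Rightarrow> 'g letter list \<Rightarrow> bool"
  for R where
  relation: "(u, v) \<in> R \<Longrightarrow> rel_equiv R u v"
| cancel_right: "rel_equiv R [Gen x, Inv x] []"
| cancel_left: "rel_equiv R [Inv x, Gen x] []"
| reflexive: "rel_equiv R u u"
| symmetric: "rel_equiv R u v \<Longrightarrow> rel_equiv R v u"
| transitive: "rel_equiv R u v \<Longrightarrow> rel_equiv R v w \<Longrightarrow> rel_equiv R u w"
| congruence: "rel_equiv R u u' \<Longrightarrow> rel_equiv R v v' \<Longrightarrow> rel_equiv R (u @ v) (u' @ v')"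

definition word_class ::
    "('g letter list \<times> 'g letter list) set \<Rightarrow> 'g letter list \<Rightarrow> 'g letter list set" where
  "word_class R u = {v. rel_equiv R u v}"

definition presented_group ::
    "('g letter list \<times> 'g letter list) set \<Rightarrow> 'g letter list set monoid" where
  "presented_group R =
    \<lparr>carrier = range (word_class R),
     mult = (\<lambda>A B. \<Union>u\<in>A. \<Union>v\<in>B. word_class R (u @ v)),
     one = word_class R []\<rparr>"

definition presented_gen ::
    "('g letter list \<times> 'g letter list) set \<Rightarrow> 'g \<Rightarrow> 'g letter list set" where
  "presented_gen R x = word_class R [Gen x]"

datatype abc = Alpha | Beta | Gamma

type_synonym abc_word = "abc letter list"

definition common_relations :: "nat \<Rightarrow> (abc_word \<times> abc_word) set" where
  "common_relations n =
    {(replicate (2 * n) (Gen Alpha), []),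
     ([Gen Beta, Gen Beta], []),
     ([Gen Gamma, Gen Gamma], []),
     ([Gen Alpha, Gen Beta, Gen Alpha, Gen Beta], []),
     ([Gen Alpha, Gen Gamma], [Gen Gamma, Gen Alpha])}"

definition G_relations :: "nat \<Rightarrow> (abc_word \<times> abc_word) set" where
  "G_relations n =
    insert ([Gen Beta, Gen Gamma], [Gen Gamma, Gen Beta]) (common_relations n)"

definition H_relations :: "nat \<Rightarrow> (abc_word \<times> abc_word) set" where
  "H_relations n =
    insert ([Gen Beta, Gen Gamma], [Gen Gamma, Gen Beta] @ replicate n (Gen Alpha))
      (common_relations n)"


subsection \<open>Permutations acting on the right\<close>

text \<open>Permutations of \<open>X\<close> are extensional functions as in \<^const>\<open>Bij\<close>, but,
  unlike in \<^const>\<open>BijGroup\<close>, the product of \<open>u\<close> and \<open>v\<close> is first \<open>u\<close>, then \<open>v\<close>.\<close>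

definition Sym :: "'a set \<Rightarrow> ('a \<Rightarrow> 'a) monoid" where
  "Sym X = \<lparr>carrier = Bij X, mult = (\<lambda>u v. compose X v u), one = (\<lambda>x\<in>X. x)\<rparr>"

definition conjugate :: "('a, 'b) monoid_scheme \<Rightarrow> 'a \<Rightarrow> 'a \<Rightarrow> 'a" where
  "conjugate G x s = inv\<^bsub>G\<^esub> s \<otimes>\<^bsub>G\<^esub> x \<otimes>\<^bsub>G\<^esub> s"


subsection \<open>The loops\<close>

text \<open>A loop is represented by a \<^typ>\<open>'a monoid\<close> record; \<open>mult\<close> need not be associative.\<close>

definition left_mult :: "('a, 'b) monoid_scheme \<Rightarrow> 'a \<Rightarrow> 'a \<Rightarrow> 'a" where
  "left_mult L x = (\<lambda>y\<in>carrier L. x \<otimes>\<^bsub>L\<^esub> y)"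

definition right_mult :: "('a, 'b) monoid_scheme \<Rightarrow> 'a \<Rightarrow> 'a \<Rightarrow> 'a" where
  "right_mult L x = (\<lambda>y\<in>carrier L. y \<otimes>\<^bsub>L\<^esub> x)"

definition left_nucleus :: "('a, 'b) monoid_scheme \<Rightarrow> 'a set" where
  "left_nucleus L = {m \<in> carrier L. \<forall>x\<in>carrier L. \<forall>y\<in>carrier L.
     m \<otimes>\<^bsub>L\<^esub> (x \<otimes>\<^bsub>L\<^esub> y) = (m \<otimes>\<^bsub>L\<^esub> x) \<otimes>\<^bsub>L\<^esub> y}"

definition Aut :: "('a, 'b) monoid_scheme \<Rightarrow> ('a \<Rightarrow> 'a) monoid" where
  "Aut L = Sym (carrier L) \<lparr>carrier := auto L\<rparr>"

definition bol_set :: "nat \<Rightarrow> (abc_word \<times> abc_word) set \<Rightarrow> abc_word set set" where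
  "bol_set n R =
    (let G = presented_group R; a = presented_gen R Alpha;
         b = presented_gen R Beta; c = presented_gen R Gamma in
     {a [^]\<^bsub>G\<^esub> (2 * i) | i::nat. 1 \<le> i \<and> i \<le> n} \<union>
     {a [^]\<^bsub>G\<^esub> (2 * j + 1) \<otimes>\<^bsub>G\<^esub> b | j::nat. 1 \<le> j \<and> j \<le> n} \<union>
     {a [^]\<^bsub>G\<^esub> k \<otimes>\<^bsub>G\<^esub> b \<otimes>\<^bsub>G\<^esub> c | k::nat. 1 \<le> k \<and> k \<le> 2 * n})"

definition beta_subgroup :: "(abc_word \<times> abc_word) set \<Rightarrow> abc_word set set" where
  "beta_subgroup R = generate (presented_group R) {presented_gen R Beta}"

definition coset_rep ::
    "nat \<Rightarrow> (abc_word \<times> abc_word) set \<Rightarrow> abc_word set set \<Rightarrow> abc_word set" where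
  "coset_rep n R X =
    (THE s. s \<in> bol_set n R \<and> beta_subgroup R #>\<^bsub>presented_group R\<^esub> s = X)"

definition bol_loop ::
    "nat \<Rightarrow> (abc_word \<times> abc_word) set \<Rightarrow> abc_word set set monoid" where
  "bol_loop n R =
    \<lparr>carrier = rcosets\<^bsub>presented_group R\<^esub> (beta_subgroup R),
     mult = (\<lambda>X Y. Y #>\<^bsub>presented_group R\<^esub> coset_rep n R X),
     one = beta_subgroup R\<rparr>"

text \<open>The loops \<open>B\<^bsub>4n\<^esub>\<close> and \<open>C\<^bsub>4n\<^esub>\<close> are \<open>bol_loop n (G_relations n)\<close> and
  \<open>bol_loop n (H_relations n)\<close>.\<close>

definition coset_action ::
    "(abc_word \<times> abc_word) set \<Rightarrow> abc_word set \<Rightarrow> abc_word set set \<Rightarrow> abc_word set set" where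
  "coset_action R g =
    (\<lambda>X \<in> rcosets\<^bsub>presented_group R\<^esub> (beta_subgroup R). X #>\<^bsub>presented_group R\<^esub> g)"


subsection \<open>The 3-net and its direction preserving collineations\<close>

definition vertical_lines :: "('a, 'b) monoid_scheme \<Rightarrow> ('a \<times> 'a) set set" where
  "vertical_lines L = {{(x, y) | y. y \<in> carrier L} | x. x \<in> carrier L}"

definition horizontal_lines :: "('a, 'b) monoid_scheme \<Rightarrow> ('a \<times> 'a) set set" where
  "horizontal_lines L = {{(x, y) | x. x \<in> carrier L} | y. y \<in> carrier L}"

definition transversal_lines :: "('a, 'b) monoid_scheme \<Rightarrow> ('a \<times> 'a) set set" where
  "transversal_lines L =
    {{(x, y) | x y. x \<in> carrier L \<and> y \<in> carrier L \<and> x \<otimes>\<^bsub>L\<^esub> y = c} | c. c \<in> carrier L}"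

definition collineations :: "('a, 'b) monoid_scheme \<Rightarrow> ('a \<times> 'a \<Rightarrow> 'a \<times> 'a) set" where
  "collineations L = {f \<in> Bij (carrier L \<times> carrier L).
     (`) f ` vertical_lines L = vertical_lines L \<and>
     (`) f ` horizontal_lines L = horizontal_lines L \<and>
     (`) f ` transversal_lines L = transversal_lines L}"

definition collineation_group ::
    "('a, 'b) monoid_scheme \<Rightarrow> ('a \<times> 'a \<Rightarrow> 'a \<times> 'a) monoid" where
  "collineation_group L = Sym (carrier L \<times> carrier L) \<lparr>carrier := collineations L\<rparr>"

text \<open>The point map written \<open>(u, v)\<close>.\<close>

definition coll ::
    "('a, 'b) monoid_scheme \<Rightarrow> ('a \<Rightarrow> 'a) \<Rightarrow> ('a \<Rightarrow> 'a) \<Rightarrow> 'a \<times> 'a \<Rightarrow> 'a \<times> 'a" where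
  "coll L u v = (\<lambda>(x, y) \<in> carrier L \<times> carrier L. (u x, v y))"

definition p_map :: "('a, 'b) monoid_scheme \<Rightarrow> 'a \<Rightarrow> 'a \<Rightarrow> 'a" where
  "p_map L x = inv\<^bsub>Sym (carrier L)\<^esub> (left_mult L x)
     \<otimes>\<^bsub>Sym (carrier L)\<^esub> inv\<^bsub>Sym (carrier L)\<^esub> (right_mult L x)"

definition N_group :: "('a, 'b) monoid_scheme \<Rightarrow> ('a \<times> 'a \<Rightarrow> 'a \<times> 'a) set" where
  "N_group L = generate (collineation_group L)
     {coll L (p_map L x) (left_mult L x) | x. x \<in> carrier L}"

definition Phi :: "('a, 'b) monoid_scheme \<Rightarrow> ('a \<times> 'a \<Rightarrow> 'a \<times> 'a) \<Rightarrow> 'a \<Rightarrow> 'a" where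
  "Phi L f = (THE v. v \<in> Bij (carrier L) \<and> (\<exists>u\<in>Bij (carrier L). f = coll L u v))"

definition T_group :: "('a, 'b) monoid_scheme \<Rightarrow> ('a \<times> 'a \<Rightarrow> 'a \<times> 'a) set" where
  "T_group L = {coll L (left_mult L m) (\<lambda>y\<in>carrier L. y) | m. m \<in> left_nucleus L}"

text \<open>\<open>G(L)\<close> consists of permutations of \<open>L\<close>, so the subgroup generated by \<open>\<alpha>\<close> and \<open>\<gamma>\<close>
  is taken through its faithful action on the cosets.\<close>

definition Lambda0 ::
    "(abc_word \<times> abc_word) set \<Rightarrow> (abc_word set set \<Rightarrow> abc_word set set) set" where
  "Lambda0 R = coset_action R `
     generate (presented_group R) {presented_gen R Alpha, presented_gen R Gamma}"

definition Lambda_group ::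
    "nat \<Rightarrow> (abc_word \<times> abc_word) set \<Rightarrow>
     (abc_word set set \<times> abc_word set set \<Rightarrow> abc_word set set \<times> abc_word set set) set" where
  "Lambda_group n R =
    {f \<in> N_group (bol_loop n R). Phi (bol_loop n R) f \<in> Lambda0 R}"

definition M_group ::
    "nat \<Rightarrow> (abc_word \<times> abc_word) set \<Rightarrow>
     (abc_word set set \<times> abc_word set set \<Rightarrow> abc_word set set \<times> abc_word set set) set" where
  "M_group n R =
    T_group (bol_loop n R) <#>\<^bsub>collineation_group (bol_loop n R)\<^esub> Lambda_group n R"


subsection \<open>Semidirect products\<close>

definition is_semidirect_product ::
    "('a, 'b) monoid_scheme \<Rightarrow> 'a set \<Rightarrow> 'a set \<Rightarrow> bool" where
  "is_semidirect_product G M A \<longleftrightarrow>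
    M \<lhd> G \<and> subgroup A G \<and> M \<inter> A = {\<one>\<^bsub>G\<^esub>} \<and> M <#>\<^bsub>G\<^esub> A = carrier G"

end

theory Submission
  imports Defs
begin

text \<open>
  A collineation \<open>(u, v)\<close> fixing the point \<open>(1, 1)\<close> satisfies \<open>u = v\<close> and is an automorphism of
  the loop.  So the theorem says that \<open>M\<close> is a complement of a point stabilizer in \<open>\<Gamma>\<close>, and it
  suffices that \<open>M\<close> is normalized by the automorphisms and acts regularly on the \<open>\<Gamma>\<close>-orbit of
  \<open>(1, 1)\<close> (lemma \<open>semidirect_product_if_regular_orbit\<close>, valid for all loops).

  Both families of groups are treated at once: put \<open>h = 0\<close> for \<open>G\<^bsub>8n\<^esub>\<close> and \<open>h = n\<close> for
  \<open>H\<^bsub>8n\<^esub>\<close>, so that \<open>\<beta>\<gamma> = \<gamma>\<beta>\<alpha>\<^sup>h\<close>, where \<open>h\<close> is even and \<open>\<alpha>\<^sup>2\<^sup>h = 1\<close>.  The cosets of \<open>\<langle>\<beta>\<rangle>\<close> are the points \<open>(k, f)\<close>, with \<open>k\<close> modulo \<open>2n\<close> and a truth value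
  \<open>f\<close>, standing for \<open>\<langle>\<beta>\<rangle>\<alpha>\<^sup>k\<gamma>\<^sup>f\<close>.  Left multiplication by \<open>(d, False)\<close> with \<open>d\<close> even is the
  rotation \<open>k \<mapsto> k + d\<close>; these elements form the left nucleus.  Left multiplication by any other
  \<open>(d, g)\<close> is a reflection \<open>k \<mapsto> d - k\<close>, corrected by \<open>h\<close> on the sheet \<open>f = True\<close>.

  In these coordinates the generators \<open>(p\<^sub>x, \<lambda>\<^sub>x)\<close> of \<open>N\<close> lie in an explicit group of collineations
  (\<open>K_group\<close>), and \<open>M\<close> is its subgroup without reflections: \<open>v\<close> is a translation by any
  \<open>(k, f)\<close>, and \<open>u\<close> translates the left nucleus by any even number and the other points by an
  amount that this number, \<open>k\<close> and \<open>f\<close> determine.  Hence \<open>M\<close> acts regularly on \<open>N\<^sub>\<lambda> \<times> L\<close>.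

  Automorphisms normalize \<open>M\<close> because every element of \<open>M\<close> has the form
  \<open>(\<lambda>\<^sub>m, id) (p\<^sub>y, \<lambda>\<^sub>y) (p\<^sub>z, \<lambda>\<^sub>z)\<close> with \<open>m\<close> in the left nucleus and \<open>y, z\<close> outside of it, and this
  description is invariant (lemmas \<open>M_factor\<close> and \<open>conjugate_M\<close>).

  It remains to see that the orbit of \<open>(1, 1)\<close> is not larger than \<open>N\<^sub>\<lambda> \<times> L\<close>.  For a
  collineation \<open>(u, v)\<close>, the permutation \<open>v\<close> conjugates \<open>\<lambda>\<^sub>x\<lambda>\<^sub>z\<^sup>-\<^sup>1\<close> to the same expression in \<open>u x\<close>
  and \<open>u z\<close>.  So the number of \<open>x\<close> such that \<open>\<lambda>\<^sub>x\<lambda>\<^sub>z\<^sup>-\<^sup>1\<close> has a nontrivial fourth power does not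
  change when \<open>z\<close> is replaced by \<open>u z\<close>.  For \<open>z = 1\<close> these \<open>x\<close> are the \<open>(d, False)\<close> with \<open>d\<close> even and
  \<open>\<alpha>\<^sup>4\<^sup>d \<noteq> 1\<close>, since reflections and products of a reflection with \<open>\<gamma>\<close> have order at most
  four.  For \<open>z\<close> outside the left nucleus there are strictly more (lemma \<open>coll_to_unit\<close>); this uses
  \<open>\<alpha>\<^sup>4 \<noteq> 1\<close>, that is, \<open>n > 2\<close>.
\<close>

section \<open>Groups given by generators and relations\<close>

lemma word_class_eq_iff: "word_class R u = word_class R v \<longleftrightarrow> rel_equiv R u v"
  unfolding word_class_def
  by (auto intro: rel_equiv.reflexive rel_equiv.symmetric rel_equiv.transitive)

lemma presented_group_carrier: "carrier (presented_group R) = range (word_class R)"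
  and presented_group_one: "\<one>\<^bsub>presented_group R\<^esub> = word_class R []"
  by (simp_all add: presented_group_def)

lemma presented_group_mult:
  "word_class R u \<otimes>\<^bsub>presented_group R\<^esub> word_class R v = word_class R (u @ v)"
proof -
  have "word_class R (u' @ v') = word_class R (u @ v)"
    if "u' \<in> word_class R u" "v' \<in> word_class R v" for u' v'
  proof -
    have "rel_equiv R (u @ v) (u' @ v')"
      using that by (auto simp: word_class_def intro: rel_equiv.congruence)
    then show ?thesis by (simp add: word_class_eq_iff rel_equiv.symmetric)
  qed
  moreover have "u \<in> word_class R u" "v \<in> word_class R v"
    by (simp_all add: word_class_def rel_equiv.reflexive)
  ultimately have "(\<Union>u'\<in>word_class R u. \<Union>v'\<in>word_class R v. word_class R (u' @ v')) =
      word_class R (u @ v)"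
    by blast
  then show ?thesis by (simp add: presented_group_def)
qed

fun formal_inverse :: "'g letter \<Rightarrow> 'g letter" where
  "formal_inverse (Gen x) = Inv x"
| "formal_inverse (Inv x) = Gen x"

lemma rel_equiv_inverse_word:
  "rel_equiv R (rev (map formal_inverse w) @ w) []"
proof (induction w)
  case Nil
  show ?case by (simp add: rel_equiv.reflexive)
next
  case (Cons l w)
  have "rel_equiv R [formal_inverse l, l] []"
    by (cases l) (simp_all add: rel_equiv.cancel_left rel_equiv.cancel_right)
  then have "rel_equiv R (([formal_inverse l, l]) @ w) ([] @ w)"
    by (rule rel_equiv.congruence) (rule rel_equiv.reflexive)
  then have "rel_equiv R (rev (map formal_inverse w) @ (([formal_inverse l, l]) @ w))
      (rev (map formal_inverse w) @ ([] @ w))"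
    by (rule rel_equiv.congruence[OF rel_equiv.reflexive])
  with Cons show ?case by (auto intro: rel_equiv.transitive)
qed

lemma group_presented_group: "group (presented_group R)"
proof (rule groupI)
  fix x assume "x \<in> carrier (presented_group R)"
  then obtain w where w: "x = word_class R w" by (auto simp: presented_group_carrier)
  have "word_class R (rev (map formal_inverse w)) \<otimes>\<^bsub>presented_group R\<^esub> x
      = \<one>\<^bsub>presented_group R\<^esub>"
    by (simp add: w presented_group_mult presented_group_one word_class_eq_iff
        rel_equiv_inverse_word)
  then show "\<exists>y\<in>carrier (presented_group R).
      y \<otimes>\<^bsub>presented_group R\<^esub> x = \<one>\<^bsub>presented_group R\<^esub>"
    by (auto simp: presented_group_carrier)
  show "\<one>\<^bsub>presented_group R\<^esub> \<otimes>\<^bsub>presented_group R\<^esub> x = x"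
    by (simp add: w presented_group_mult presented_group_one)
qed (auto simp: presented_group_carrier presented_group_mult presented_group_one)

lemma presented_gen_closed: "presented_gen R x \<in> carrier (presented_group R)"
  by (simp add: presented_gen_def presented_group_carrier)

lemma word_class_replicate:
  "word_class R (replicate k (Gen x)) = presented_gen R x [^]\<^bsub>presented_group R\<^esub> k"
proof (induction k)
  case 0
  show ?case by (simp add: presented_group_one)
next
  case (Suc k)
  have "word_class R (replicate k (Gen x) @ [Gen x]) =
      word_class R (replicate k (Gen x)) \<otimes>\<^bsub>presented_group R\<^esub> presented_gen R x"
    by (simp only: presented_gen_def presented_group_mult)
  with Suc show ?case by (simp add: replicate_append_same)
qed

lemma word_class_inverse_letter:
  "word_class R [Inv x] = inv\<^bsub>presented_group R\<^esub> presented_gen R x"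
proof -
  interpret group "presented_group R" by (rule group_presented_group)
  have "word_class R [Inv x] \<otimes>\<^bsub>presented_group R\<^esub> presented_gen R x = \<one>\<^bsub>presented_group R\<^esub>"
    by (simp add: presented_gen_def presented_group_mult presented_group_one word_class_eq_iff
        rel_equiv.cancel_left)
  then show ?thesis
    by (intro inv_equality[symmetric]) (simp_all add: presented_gen_closed, simp add: presented_group_carrier)
qed

section \<open>The two Bol loops in coordinates\<close>

lemma even_iff_if_dvd_diff:
  fixes d d' m :: int
  assumes "2 * m dvd d - d'"
  shows "even d = even d'"
proof -
  have "even (d - d')" using assms by (rule dvd_mult_left)
  then show ?thesis by simp
qed

text \<open>The parameter \<open>h\<close> is \<open>0\<close> for \<open>B\<^bsub>4n\<^esub>\<close> and \<open>n\<close> for \<open>C\<^bsub>4n\<^esub>\<close>.  Its evenness makes the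
  parity of the exponent of \<open>\<alpha>\<close> meaningful, and \<open>2h\<close> is a multiple of \<open>2n\<close> in both cases.\<close>

locale bol_presentation =
  fixes n h :: nat and R :: "(abc_word \<times> abc_word) set"
  assumes n_gt_2: "n > 2"
    and h_cases: "h = 0 \<or> h = n"
    and even_h: "even h"
    and R_eq: "R = insert ([Gen Beta, Gen Gamma], [Gen Gamma, Gen Beta] @ replicate h (Gen Alpha))
      (common_relations n)"
begin

abbreviation G where "G \<equiv> presented_group R"
abbreviation a where "a \<equiv> presented_gen R Alpha"
abbreviation b where "b \<equiv> presented_gen R Beta"
abbreviation c where "c \<equiv> presented_gen R Gamma"
abbreviation H where "H \<equiv> beta_subgroup R"

sublocale group G by (rule group_presented_group)

lemma gens_closed [simp, intro]:
  "a \<in> carrier G" "b \<in> carrier G" "c \<in> carrier G"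
  by (rule presented_gen_closed)+

lemma gens_relations:
  shows a_order: "a [^]\<^bsub>G\<^esub> (2 * n) = \<one>\<^bsub>G\<^esub>"
    and b_square: "b \<otimes>\<^bsub>G\<^esub> b = \<one>\<^bsub>G\<^esub>"
    and c_square: "c \<otimes>\<^bsub>G\<^esub> c = \<one>\<^bsub>G\<^esub>"
    and ab_square: "a \<otimes>\<^bsub>G\<^esub> b \<otimes>\<^bsub>G\<^esub> a \<otimes>\<^bsub>G\<^esub> b = \<one>\<^bsub>G\<^esub>"
    and ac_commute: "a \<otimes>\<^bsub>G\<^esub> c = c \<otimes>\<^bsub>G\<^esub> a"
    and bc_relation: "b \<otimes>\<^bsub>G\<^esub> c = c \<otimes>\<^bsub>G\<^esub> b \<otimes>\<^bsub>G\<^esub> a [^]\<^bsub>G\<^esub> h"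
proof -
  have rel: "word_class R u = word_class R v" if "(u, v) \<in> R" for u v
    using that by (simp add: word_class_eq_iff rel_equiv.relation)
  show "a [^]\<^bsub>G\<^esub> (2 * n) = \<one>\<^bsub>G\<^esub>"
    unfolding presented_group_one word_class_replicate[symmetric]
    by (rule rel) (simp add: R_eq common_relations_def)
  show "b \<otimes>\<^bsub>G\<^esub> b = \<one>\<^bsub>G\<^esub>" "c \<otimes>\<^bsub>G\<^esub> c = \<one>\<^bsub>G\<^esub>"
    "a \<otimes>\<^bsub>G\<^esub> b \<otimes>\<^bsub>G\<^esub> a \<otimes>\<^bsub>G\<^esub> b = \<one>\<^bsub>G\<^esub>" "a \<otimes>\<^bsub>G\<^esub> c = c \<otimes>\<^bsub>G\<^esub> a"
    unfolding presented_group_one presented_gen_def presented_group_mult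
    by (rule rel, simp add: R_eq common_relations_def)+
  have "word_class R ([Gen Beta] @ [Gen Gamma]) =
      word_class R ([Gen Gamma] @ [Gen Beta] @ replicate h (Gen Alpha))"
    by (rule rel) (simp add: R_eq)
  then show "b \<otimes>\<^bsub>G\<^esub> c = c \<otimes>\<^bsub>G\<^esub> b \<otimes>\<^bsub>G\<^esub> a [^]\<^bsub>G\<^esub> h"
    by (simp only: presented_group_mult[symmetric] word_class_replicate
        presented_gen_def[symmetric] m_assoc gens_closed nat_pow_closed)
qed

lemma a_add: "a [^]\<^bsub>G\<^esub> (i + j :: int) = a [^]\<^bsub>G\<^esub> i \<otimes>\<^bsub>G\<^esub> a [^]\<^bsub>G\<^esub> j"
  by (simp add: int_pow_mult)

lemma a_cong: "a [^]\<^bsub>G\<^esub> i = a [^]\<^bsub>G\<^esub> j" if "2 * int n dvd i - j" for i j :: int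
proof -
  obtain t where "i - j = 2 * int n * t"
    using \<open>2 * int n dvd i - j\<close> by (elim dvdE)
  then have t: "i = j + 2 * int n * t" by simp
  have "a [^]\<^bsub>G\<^esub> (2 * int n) = \<one>\<^bsub>G\<^esub>"
    using a_order int_pow_int[of G a "2 * n"] by simp
  then have "a [^]\<^bsub>G\<^esub> (2 * int n * t) = \<one>\<^bsub>G\<^esub>"
    by (metis gens_closed(1) int_pow_one int_pow_pow)
  then show ?thesis by (simp add: t a_add)
qed

lemma inv_b: "inv\<^bsub>G\<^esub> b = b" and inv_c: "inv\<^bsub>G\<^esub> c = c"
  by (simp_all add: b_square c_square inv_equality)

text \<open>The relations \<open>(\<alpha>\<beta>)\<^sup>2 = \<beta>\<^sup>2 = 1\<close> make \<open>\<beta>\<close> invert \<open>\<alpha>\<close>.\<close>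

lemma a_b: "a [^]\<^bsub>G\<^esub> k \<otimes>\<^bsub>G\<^esub> b = b \<otimes>\<^bsub>G\<^esub> a [^]\<^bsub>G\<^esub> (- k)" for k :: int
proof -
  have ab: "a \<otimes>\<^bsub>G\<^esub> b = b \<otimes>\<^bsub>G\<^esub> inv\<^bsub>G\<^esub> a"
  proof -
    have "(a \<otimes>\<^bsub>G\<^esub> b) \<otimes>\<^bsub>G\<^esub> (a \<otimes>\<^bsub>G\<^esub> b) = \<one>\<^bsub>G\<^esub>"
      using ab_square by (simp add: m_assoc)
    then have "inv\<^bsub>G\<^esub> (a \<otimes>\<^bsub>G\<^esub> b) = a \<otimes>\<^bsub>G\<^esub> b" by (simp add: inv_equality)
    then show ?thesis by (simp add: inv_mult_group inv_b)
  qed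
  then have ba: "a [^]\<^bsub>G\<^esub> (-1 :: int) \<otimes>\<^bsub>G\<^esub> b = b \<otimes>\<^bsub>G\<^esub> a"
    by (simp add: int_pow_neg)
      (metis gens_closed inv_closed inv_inv m_assoc inv_b inv_mult_group m_closed inv_solve_left)
  show ?thesis
  proof (induction k rule: int_induct[where k = 0])
    case base
    show ?case by simp
  next
    case (step1 i)
    have "a [^]\<^bsub>G\<^esub> (i + 1) \<otimes>\<^bsub>G\<^esub> b = a [^]\<^bsub>G\<^esub> i \<otimes>\<^bsub>G\<^esub> (a \<otimes>\<^bsub>G\<^esub> b)"
      by (simp add: a_add m_assoc)
    also have "\<dots> = (a [^]\<^bsub>G\<^esub> i \<otimes>\<^bsub>G\<^esub> b) \<otimes>\<^bsub>G\<^esub> inv\<^bsub>G\<^esub> a" by (simp add: ab m_assoc)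
    also have "\<dots> = b \<otimes>\<^bsub>G\<^esub> (a [^]\<^bsub>G\<^esub> (- i) \<otimes>\<^bsub>G\<^esub> a [^]\<^bsub>G\<^esub> (- 1 :: int))"
      by (simp add: step1 m_assoc int_pow_neg)
    finally show ?case by (simp flip: a_add)
  next
    case (step2 i)
    have "a [^]\<^bsub>G\<^esub> (i + (-1)) \<otimes>\<^bsub>G\<^esub> b = a [^]\<^bsub>G\<^esub> i \<otimes>\<^bsub>G\<^esub> (a [^]\<^bsub>G\<^esub> (-1 :: int) \<otimes>\<^bsub>G\<^esub> b)"
      by (simp only: a_add) (simp add: m_assoc)
    also have "\<dots> = (a [^]\<^bsub>G\<^esub> i \<otimes>\<^bsub>G\<^esub> b) \<otimes>\<^bsub>G\<^esub> a" by (simp only: ba) (simp add: m_assoc)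
    also have "\<dots> = b \<otimes>\<^bsub>G\<^esub> (a [^]\<^bsub>G\<^esub> (- i) \<otimes>\<^bsub>G\<^esub> a [^]\<^bsub>G\<^esub> (1 :: int))"
      by (simp only: step2) (simp add: m_assoc)
    also have "a [^]\<^bsub>G\<^esub> (- i) \<otimes>\<^bsub>G\<^esub> a [^]\<^bsub>G\<^esub> (1 :: int) = a [^]\<^bsub>G\<^esub> (- (i - 1))"
      by (simp only: a_add[symmetric]) simp
    finally show ?case by simp
  qed
qed

text \<open>Since \<open>\<alpha>\<close> has finite order, nonnegative exponents suffice.\<close>

lemma a_c: "a [^]\<^bsub>G\<^esub> k \<otimes>\<^bsub>G\<^esub> c = c \<otimes>\<^bsub>G\<^esub> a [^]\<^bsub>G\<^esub> k" for k :: int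
proof -
  have nat: "a [^]\<^bsub>G\<^esub> j \<otimes>\<^bsub>G\<^esub> c = c \<otimes>\<^bsub>G\<^esub> a [^]\<^bsub>G\<^esub> j" for j :: nat
    by (rule group_commutes_pow) (simp_all add: ac_commute)
  have "2 * int n dvd k - int (nat (k mod (2 * int n)))"
    using n_gt_2 by (simp add: mod_eq_dvd_iff)
  then have "a [^]\<^bsub>G\<^esub> k = a [^]\<^bsub>G\<^esub> nat (k mod (2 * int n))"
    using a_cong[of k "int (nat (k mod (2 * int n)))"] by (simp add: int_pow_int)
  then show ?thesis by (simp add: nat)
qed

lemma two_h: "2 * int n dvd 2 * int h"
  using h_cases by auto

text \<open>The relation \<open>\<beta>\<gamma> = \<gamma>\<beta>\<alpha>\<^sup>h\<close> solved for \<open>\<gamma>\<beta>\<close>; this is where \<open>\<alpha>\<^sup>2\<^sup>h = 1\<close> enters.\<close>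

lemma c_b: "c \<otimes>\<^bsub>G\<^esub> b = b \<otimes>\<^bsub>G\<^esub> a [^]\<^bsub>G\<^esub> int h \<otimes>\<^bsub>G\<^esub> c"
proof -
  have "b \<otimes>\<^bsub>G\<^esub> a [^]\<^bsub>G\<^esub> int h \<otimes>\<^bsub>G\<^esub> c = (b \<otimes>\<^bsub>G\<^esub> c) \<otimes>\<^bsub>G\<^esub> a [^]\<^bsub>G\<^esub> int h"
    by (simp add: m_assoc a_c)
  also have "\<dots> = c \<otimes>\<^bsub>G\<^esub> b \<otimes>\<^bsub>G\<^esub> (a [^]\<^bsub>G\<^esub> int h \<otimes>\<^bsub>G\<^esub> a [^]\<^bsub>G\<^esub> int h)"
    by (simp add: bc_relation m_assoc flip: int_pow_int)
  also have "\<dots> = c \<otimes>\<^bsub>G\<^esub> b \<otimes>\<^bsub>G\<^esub> a [^]\<^bsub>G\<^esub> (2 * int h)" by (simp flip: a_add)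
  also have "a [^]\<^bsub>G\<^esub> (2 * int h) = \<one>\<^bsub>G\<^esub>"
    using a_cong[of "2 * int h" 0] two_h by simp
  finally show ?thesis by simp
qed

lemma H_eq: "H = {\<one>\<^bsub>G\<^esub>, b}"
proof
  have "subgroup {\<one>\<^bsub>G\<^esub>, b} G"
    by (rule subgroupI) (auto simp: inv_b b_square)
  then show "H \<subseteq> {\<one>\<^bsub>G\<^esub>, b}"
    unfolding beta_subgroup_def by (intro generate_subgroup_incl) auto
  show "{\<one>\<^bsub>G\<^esub>, b} \<subseteq> H"
    by (auto simp: beta_subgroup_def intro: generate.one generate.incl)
qed

lemma H_subgroup: "subgroup H G"
  unfolding beta_subgroup_def by (rule generate_is_subgroup) simp

lemma H_subset: "H \<subseteq> carrier G"
  by (rule subgroup.subset[OF H_subgroup])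

text \<open>As \<open>\<gamma>\<^sup>2 = 1\<close>, powers of \<open>\<gamma>\<close> are indexed by truth values, with exclusive or as addition.\<close>

definition c_pow :: "bool \<Rightarrow> abc_word set" where
  "c_pow f = (if f then c else \<one>\<^bsub>G\<^esub>)"

lemma c_pow_closed [simp, intro]: "c_pow f \<in> carrier G"
  by (simp add: c_pow_def)

lemma a_c_pow: "a [^]\<^bsub>G\<^esub> k \<otimes>\<^bsub>G\<^esub> c_pow f = c_pow f \<otimes>\<^bsub>G\<^esub> a [^]\<^bsub>G\<^esub> k" for k :: int
  by (simp add: c_pow_def a_c)

lemma c_pow_mult: "c_pow f \<otimes>\<^bsub>G\<^esub> c_pow g = c_pow (f \<noteq> g)"
  by (simp add: c_pow_def c_square)

definition pt :: "int \<Rightarrow> bool \<Rightarrow> abc_word set set" where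
  "pt k f = H #>\<^bsub>G\<^esub> (a [^]\<^bsub>G\<^esub> k \<otimes>\<^bsub>G\<^esub> c_pow f)"

lemma pt_mult_a: "pt k f #>\<^bsub>G\<^esub> a [^]\<^bsub>G\<^esub> (j :: int) = pt (k + j) f"
  by (simp add: pt_def coset_mult_assoc H_subset a_add m_assoc flip: a_c_pow)

lemma pt_mult_c: "pt k f #>\<^bsub>G\<^esub> c_pow g = pt k (f \<noteq> g)"
  by (simp add: pt_def coset_mult_assoc H_subset m_assoc c_pow_mult)

lemma coset_b: "H #>\<^bsub>G\<^esub> (b \<otimes>\<^bsub>G\<^esub> x) = H #>\<^bsub>G\<^esub> x" if "x \<in> carrier G"
proof -
  have "H #>\<^bsub>G\<^esub> b = H"
    by (rule coset_join2) (simp_all add: H_subgroup, simp add: H_eq)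
  then show ?thesis using that coset_mult_assoc[OF H_subset, of b x] by simp
qed

text \<open>Moving \<open>\<beta>\<close> to the left, where the coset absorbs it, inverts \<open>\<alpha>\<^sup>k\<close> and costs a factor
  \<open>\<alpha>\<^sup>h\<close> when it passes \<open>\<gamma>\<close>.\<close>

lemma pt_mult_b: "pt k f #>\<^bsub>G\<^esub> b = pt (of_bool f * int h - k) f"
proof -
  have "c_pow f \<otimes>\<^bsub>G\<^esub> b = b \<otimes>\<^bsub>G\<^esub> a [^]\<^bsub>G\<^esub> (of_bool f * int h) \<otimes>\<^bsub>G\<^esub> c_pow f"
    by (simp add: c_pow_def c_b)
  then have "a [^]\<^bsub>G\<^esub> k \<otimes>\<^bsub>G\<^esub> c_pow f \<otimes>\<^bsub>G\<^esub> b
      = (a [^]\<^bsub>G\<^esub> k \<otimes>\<^bsub>G\<^esub> b) \<otimes>\<^bsub>G\<^esub> a [^]\<^bsub>G\<^esub> (of_bool f * int h) \<otimes>\<^bsub>G\<^esub> c_pow f"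
    by (simp add: m_assoc)
  also have "\<dots> = b \<otimes>\<^bsub>G\<^esub> (a [^]\<^bsub>G\<^esub> (- k + of_bool f * int h) \<otimes>\<^bsub>G\<^esub> c_pow f)"
    by (simp only: a_b a_add) (simp add: m_assoc)
  finally show ?thesis
    by (simp add: pt_def coset_mult_assoc H_subset coset_b)
qed

lemma coset_is_pt: "\<exists>k f. H #>\<^bsub>G\<^esub> word_class R w = pt k f"
proof (induction w rule: rev_induct)
  case Nil
  have "H #>\<^bsub>G\<^esub> word_class R [] = pt 0 False"
    by (simp add: pt_def c_pow_def flip: presented_group_one)
  then show ?case by blast
next
  case (snoc l w)
  then obtain k f where "H #>\<^bsub>G\<^esub> word_class R w = pt k f" by blast
  then have *: "H #>\<^bsub>G\<^esub> word_class R (w @ [l]) = pt k f #>\<^bsub>G\<^esub> word_class R [l]"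
    using coset_mult_assoc[OF H_subset, of "word_class R w" "word_class R [l]"]
    by (simp add: presented_group_carrier presented_group_mult)
  have "\<exists>k' f'. pt k f #>\<^bsub>G\<^esub> presented_gen R x = pt k' f'
      \<and> (\<exists>k' f'. pt k f #>\<^bsub>G\<^esub> inv\<^bsub>G\<^esub> presented_gen R x = pt k' f')" for x
  proof (cases x)
    case Alpha
    then show ?thesis
      using pt_mult_a[of k f 1] pt_mult_a[of k f "-1"] by (auto simp: int_pow_neg)
  next
    case Beta
    then show ?thesis by (auto simp: inv_b pt_mult_b)
  next
    case Gamma
    then show ?thesis using pt_mult_c[of k f True] by (auto simp: inv_c c_pow_def)
  qed
  then show ?case
    using * by (cases l) (simp_all add: word_class_inverse_letter flip: presented_gen_def)
qed

lemma rcosets_eq: "rcosets\<^bsub>G\<^esub> H = {pt k f | k f. True}"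
proof
  show "rcosets\<^bsub>G\<^esub> H \<subseteq> {pt k f | k f. True}"
    using coset_is_pt by (auto simp: RCOSETS_def presented_group_carrier)
  show "{pt k f | k f. True} \<subseteq> rcosets\<^bsub>G\<^esub> H"
    by (auto simp: pt_def intro!: rcosetsI H_subset)
qed

text \<open>A presentation gives only upper bounds.  That distinct coordinates belong to distinct cosets
  is seen in a model: words act on pairs \<open>(k, f)\<close> by the formulas above, and the relations hold
  there modulo \<open>2n\<close>.\<close>

fun act :: "abc letter \<Rightarrow> int \<times> bool \<Rightarrow> int \<times> bool" where
  "act (Gen Alpha) (k, f) = (k + 1, f)"
| "act (Inv Alpha) (k, f) = (k - 1, f)"
| "act (Gen Beta) (k, f) = (of_bool f * int h - k, f)"
| "act (Inv Beta) (k, f) = (of_bool f * int h - k, f)"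
| "act (Gen Gamma) (k, f) = (k, \<not> f)"
| "act (Inv Gamma) (k, f) = (k, \<not> f)"

definition same_pt :: "int \<times> bool \<Rightarrow> int \<times> bool \<Rightarrow> bool" where
  "same_pt p q \<longleftrightarrow> 2 * int n dvd fst p - fst q \<and> snd p = snd q"

lemma same_pt_refl: "same_pt p p"
  by (simp add: same_pt_def)

lemma same_pt_sym: "same_pt p q \<Longrightarrow> same_pt q p"
  by (auto simp: same_pt_def dvd_diff_commute)

lemma same_pt_trans: "same_pt p q \<Longrightarrow> same_pt q r \<Longrightarrow> same_pt p r"
  using dvd_add[of "2 * int n" "fst p - fst q" "fst q - fst r"] by (auto simp: same_pt_def)

lemma act_same_pt: "same_pt (act l p) (act l q)" if "same_pt p q"
proof (cases p; cases q)
  fix k f k' f' assume "p = (k, f)" "q = (k', f')"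
  with that show ?thesis
    by (cases "(l, p)" rule: act.cases) (auto simp: same_pt_def dvd_diff_commute)
qed

lemma fold_act_same_pt: "same_pt p q \<Longrightarrow> same_pt (fold act w p) (fold act w q)"
  by (induction w arbitrary: p q) (simp_all add: act_same_pt)

lemma act_Alpha_funpow: "(act (Gen Alpha) ^^ m) (k, f) = (k + int m, f)"
  by (induction m) auto

lemma rel_equiv_fold_act:
  "rel_equiv R u v \<Longrightarrow> same_pt (fold act u p) (fold act v p)"
proof (induction arbitrary: p rule: rel_equiv.induct)
  case (relation u v)
  obtain k f where "p = (k, f)" by (cases p)
  with relation show ?case
    using two_h by (cases f) (auto simp: R_eq common_relations_def act_Alpha_funpow same_pt_def)
next
  case (cancel_right x)
  show ?case by (cases p; cases x) (simp_all add: same_pt_refl)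
next
  case (cancel_left x)
  show ?case by (cases p; cases x) (simp_all add: same_pt_refl)
next
  case (congruence u u' v v')
  from congruence.IH(1) have "same_pt (fold act v (fold act u p)) (fold act v (fold act u' p))"
    by (rule fold_act_same_pt)
  also note congruence.IH(2)
  finally (same_pt_trans) show ?case by simp
next
  case (transitive u v w)
  then show ?case by (blast intro: same_pt_trans)
qed (simp_all add: same_pt_refl same_pt_sym)

text \<open>Words in the same coset of \<open>\<langle>\<beta>\<rangle>\<close> move the pair \<open>(0, False)\<close> to the same place, because
  \<open>\<beta>\<close> fixes this pair.\<close>

lemma pt_eq_iff: "pt k f = pt k' f' \<longleftrightarrow> 2 * int n dvd k - k' \<and> f = f'"
proof
  \<comment> \<open>a word for the representative \<open>\<alpha>\<^sup>k\<gamma>\<^sup>f\<close> of \<open>pt k f\<close>\<close>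
  define w where "w = (\<lambda>k f. replicate (nat (k mod (2 * int n))) (Gen Alpha) @
    (if f then [Gen Gamma] else []))"
  have pt_w: "pt k f = H #>\<^bsub>G\<^esub> word_class R (w k f)" for k f
  proof -
    have "a [^]\<^bsub>G\<^esub> k = a [^]\<^bsub>G\<^esub> (k mod (2 * int n))" by (rule a_cong) simp
    also have "\<dots> = a [^]\<^bsub>G\<^esub> nat (k mod (2 * int n))"
      using n_gt_2 by (simp flip: int_pow_int)
    finally show ?thesis
      by (simp add: pt_def w_def c_pow_def presented_group_one word_class_replicate
          presented_gen_def flip: presented_group_mult)
  qed
  have act_w: "same_pt (fold act (w k f) (0, False)) (k, f)" for k f
    using n_gt_2 by (simp add: w_def act_Alpha_funpow same_pt_def flip: mod_eq_dvd_iff)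
  have coset_word: "H #>\<^bsub>G\<^esub> word_class R v = {word_class R v, word_class R (Gen Beta # v)}" for v
    by (auto simp: r_coset_def H_eq presented_group_one presented_gen_def presented_group_mult)
  have "word_class R (w k f) \<in> H #>\<^bsub>G\<^esub> word_class R (w k f)" by (simp add: coset_word)
  also assume "pt k f = pt k' f'"
  then have "H #>\<^bsub>G\<^esub> word_class R (w k f) = H #>\<^bsub>G\<^esub> word_class R (w k' f')"
    by (simp only: pt_w)
  finally have "rel_equiv R (w k f) (w k' f') \<or> rel_equiv R (w k f) (Gen Beta # w k' f')"
    by (simp add: coset_word word_class_eq_iff)
  then have "same_pt (fold act (w k f) (0, False)) (fold act (w k' f') (0, False))"
    using rel_equiv_fold_act[of "w k f" "w k' f'" "(0, False)"]
      rel_equiv_fold_act[of "w k f" "Gen Beta # w k' f'" "(0, False)"] by auto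
  then have "same_pt (k, f) (k', f')"
    by (meson act_w same_pt_sym same_pt_trans)
  then show "2 * int n dvd k - k' \<and> f = f'" by (simp add: same_pt_def)
next
  assume "2 * int n dvd k - k' \<and> f = f'"
  then show "pt k f = pt k' f'" by (auto simp: pt_def dest: a_cong)
qed

lemma pt_0: "pt 0 False = H"
  using coset_join2[OF _ H_subgroup, of "\<one>\<^bsub>G\<^esub>"] subgroup.one_closed[OF H_subgroup]
  by (simp add: pt_def c_pow_def)

text \<open>The element of \<open>S\<close> that maps \<open>\<langle>\<beta>\<rangle>\<close> to \<open>pt d f\<close> (lemma \<open>H_rep\<close>).  The sign of the exponent
  in the second case is undone by \<open>\<beta>\<close>.\<close>

definition rep :: "int \<Rightarrow> bool \<Rightarrow> abc_word set" where
  "rep d f = (if \<not> f \<and> even d then a [^]\<^bsub>G\<^esub> d else a [^]\<^bsub>G\<^esub> (- d) \<otimes>\<^bsub>G\<^esub> b \<otimes>\<^bsub>G\<^esub> c_pow f)"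

lemma rep_closed [simp, intro]: "rep d f \<in> carrier G"
  by (simp add: rep_def)

lemma pt_mult_rep:
  "pt k f #>\<^bsub>G\<^esub> rep d g =
    (if \<not> g \<and> even d then pt (k + d) f else pt (d - k + of_bool f * int h) (f \<noteq> g))"
proof -
  have sub: "pt k f \<subseteq> carrier G"
    by (simp add: pt_def r_coset_subset_G H_subset)
  have "pt k f #>\<^bsub>G\<^esub> (a [^]\<^bsub>G\<^esub> (- d) \<otimes>\<^bsub>G\<^esub> b \<otimes>\<^bsub>G\<^esub> c_pow g)
      = pt k f #>\<^bsub>G\<^esub> a [^]\<^bsub>G\<^esub> (- d) #>\<^bsub>G\<^esub> b #>\<^bsub>G\<^esub> c_pow g"
    using sub by (simp add: coset_mult_assoc r_coset_subset_G)
  also have "\<dots> = pt (of_bool f * int h - (k - d)) (f \<noteq> g)"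
    by (simp only: pt_mult_a pt_mult_b pt_mult_c) simp
  finally show ?thesis by (auto simp: rep_def pt_mult_a algebra_simps)
qed

lemma H_rep: "H #>\<^bsub>G\<^esub> rep d f = pt d f"
  using pt_mult_rep[of 0 False d f] by (auto simp: pt_0)

lemma rep_cong: "rep d f = rep d' f" if "2 * int n dvd d - d'"
proof -
  have "2 * int n dvd - d - - d'" using that by (simp add: dvd_diff_commute)
  then show ?thesis
    using a_cong[of d d'] a_cong[of "- d" "- d'"] that even_iff_if_dvd_diff[OF that] by (simp add: rep_def)
qed

text \<open>The exponents in the definition of \<open>S\<close> run through a full period of \<open>\<alpha>\<close>, so they may as well
  be arbitrary integers.\<close>

lemma bol_set_eq: "bol_set n R = {rep d f | d f. True}"
proof
  have nat_even: "a [^]\<^bsub>G\<^esub> (2 * i) = rep (2 * int i) False" for i :: nat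
    by (simp add: rep_def flip: int_pow_int)
  have nat_odd: "a [^]\<^bsub>G\<^esub> (2 * j + 1) \<otimes>\<^bsub>G\<^esub> b = rep (- (2 * int j + 1)) False" for j :: nat
    by (simp add: rep_def c_pow_def add.commute flip: int_pow_int)
  have nat_refl: "a [^]\<^bsub>G\<^esub> k \<otimes>\<^bsub>G\<^esub> b \<otimes>\<^bsub>G\<^esub> c = rep (- int k) True" for k :: nat
    by (simp add: rep_def c_pow_def flip: int_pow_int)
  show "bol_set n R \<subseteq> {rep d f | d f. True}"
    unfolding bol_set_def Let_def nat_even nat_odd nat_refl by blast
  show "{rep d f | d f. True} \<subseteq> bol_set n R"
  proof
    have in_range: "\<exists>i. 1 \<le> i \<and> i \<le> m \<and> int m dvd k - int i" if "m > 0" for m :: nat and k :: int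
    proof -
      let ?i = "nat ((k - 1) mod int m) + 1"
      have "(k - 1) mod int m < int m" "0 \<le> (k - 1) mod int m" using that by simp_all
      then have "1 \<le> ?i" "?i \<le> m" by (simp_all add: nat_less_iff Suc_le_eq)
      moreover have "k - int ?i = (k - 1) - (k - 1) mod int m"
        using that by simp
      then have "int m dvd k - int ?i" by (simp add: minus_mod_eq_mult_div)
      ultimately show ?thesis by blast
    qed
    fix s assume "s \<in> {rep d f | d f. True}"
    then obtain d f where s: "s = rep d f" by blast
    consider "f" | "\<not> f" "even d" | "\<not> f" "odd d" by blast
    then show "s \<in> bol_set n R"
    proof cases
      case 1
      obtain k where k: "1 \<le> k" "k \<le> 2 * n" "int (2 * n) dvd - d - int k"
        using in_range[of "2 * n" "- d"] n_gt_2 by auto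
      have "d - - int k = - (- d - int k)" by simp
      then have "2 * int n dvd d - - int k"
        using k(3) by (simp only: dvd_minus_iff) simp
      then have "s = rep (- int k) True" using 1 s rep_cong by simp
      with k show ?thesis unfolding bol_set_def Let_def nat_even nat_odd nat_refl by blast
    next
      case 2
      then obtain e where e: "d = 2 * e" by blast
      obtain i where i: "1 \<le> i" "i \<le> n" "int n dvd e - int i"
        using in_range[of n e] n_gt_2 by auto
      have "d - 2 * int i = 2 * (e - int i)" by (simp add: e)
      then have "2 * int n dvd d - 2 * int i"
        by (simp only:) (intro mult_dvd_mono dvd_refl i(3))
      then have "s = rep (2 * int i) False" using 2 s rep_cong by simp
      with i show ?thesis unfolding bol_set_def Let_def nat_even nat_odd nat_refl by blast
    next
      case 3
      then obtain e where e: "d = 2 * e + 1" by (elim oddE)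
      obtain j where j: "1 \<le> j" "j \<le> n" "int n dvd (- e - 1) - int j"
        using in_range[of n "- e - 1"] n_gt_2 by auto
      have "d - - (2 * int j + 1) = - (2 * ((- e - 1) - int j))" by (simp add: e)
      then have "2 * int n dvd d - - (2 * int j + 1)"
        by (simp only: dvd_minus_iff) (intro mult_dvd_mono dvd_refl j(3))
      then have "s = rep (- (2 * int j + 1)) False" using 3 s rep_cong by simp
      with j show ?thesis unfolding bol_set_def Let_def nat_even nat_odd nat_refl by blast
    qed
  qed
qed

lemma coset_rep_pt: "coset_rep n R (pt d f) = rep d f"
  unfolding coset_rep_def
proof (rule the_equality)
  show "rep d f \<in> bol_set n R \<and> H #>\<^bsub>G\<^esub> rep d f = pt d f"
    by (auto simp: bol_set_eq H_rep)
  fix s assume "s \<in> bol_set n R \<and> H #>\<^bsub>G\<^esub> s = pt d f"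
  then obtain d' f' where "s = rep d' f'" "pt d' f' = pt d f"
    by (auto simp: bol_set_eq H_rep)
  then show "s = rep d f" using rep_cong[of d' d f] by (simp add: pt_eq_iff)
qed

lemma bol_loop_carrier: "carrier (bol_loop n R) = {pt k f | k f. True}"
  by (simp add: bol_loop_def rcosets_eq)

lemma bol_loop_one: "\<one>\<^bsub>bol_loop n R\<^esub> = pt 0 False"
  by (simp add: bol_loop_def pt_0)

lemma bol_loop_mult:
  "pt d g \<otimes>\<^bsub>bol_loop n R\<^esub> pt k f =
    (if \<not> g \<and> even d then pt (k + d) f else pt (d - k + of_bool f * int h) (f \<noteq> g))"
  by (simp add: bol_loop_def coset_rep_pt pt_mult_rep)

lemma generate_a_c: "generate G {a, c} = {a [^]\<^bsub>G\<^esub> k \<otimes>\<^bsub>G\<^esub> c_pow f | (k :: int) f. True}"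
proof
  let ?K = "{a [^]\<^bsub>G\<^esub> k \<otimes>\<^bsub>G\<^esub> c_pow f | (k :: int) f. True}"
  have mult: "(a [^]\<^bsub>G\<^esub> k \<otimes>\<^bsub>G\<^esub> c_pow f) \<otimes>\<^bsub>G\<^esub> (a [^]\<^bsub>G\<^esub> k' \<otimes>\<^bsub>G\<^esub> c_pow f')
      = a [^]\<^bsub>G\<^esub> (k + k') \<otimes>\<^bsub>G\<^esub> c_pow (f \<noteq> f')" for k k' :: int and f f'
  proof -
    have "(a [^]\<^bsub>G\<^esub> k \<otimes>\<^bsub>G\<^esub> c_pow f) \<otimes>\<^bsub>G\<^esub> (a [^]\<^bsub>G\<^esub> k' \<otimes>\<^bsub>G\<^esub> c_pow f')
      = a [^]\<^bsub>G\<^esub> k \<otimes>\<^bsub>G\<^esub> (c_pow f \<otimes>\<^bsub>G\<^esub> a [^]\<^bsub>G\<^esub> k') \<otimes>\<^bsub>G\<^esub> c_pow f'"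
      by (simp add: m_assoc)
    also have "\<dots> = (a [^]\<^bsub>G\<^esub> k \<otimes>\<^bsub>G\<^esub> a [^]\<^bsub>G\<^esub> k') \<otimes>\<^bsub>G\<^esub> (c_pow f \<otimes>\<^bsub>G\<^esub> c_pow f')"
      by (simp add: m_assoc flip: a_c_pow)
    finally show ?thesis by (simp add: a_add c_pow_mult)
  qed
  have "subgroup ?K G"
  proof (rule subgroupI)
    fix x assume "x \<in> ?K"
    then obtain k :: int and f where x: "x = a [^]\<^bsub>G\<^esub> k \<otimes>\<^bsub>G\<^esub> c_pow f" by blast
    have "(a [^]\<^bsub>G\<^esub> (- k) \<otimes>\<^bsub>G\<^esub> c_pow f) \<otimes>\<^bsub>G\<^esub> x = \<one>\<^bsub>G\<^esub>"
      by (simp add: x mult) (simp add: c_pow_def)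
    then have "inv\<^bsub>G\<^esub> x = a [^]\<^bsub>G\<^esub> (- k) \<otimes>\<^bsub>G\<^esub> c_pow f"
      by (intro inv_equality) (simp_all add: x)
    then show "inv\<^bsub>G\<^esub> x \<in> ?K" by blast
    fix y assume "y \<in> ?K"
    then obtain k' :: int and f' where "y = a [^]\<^bsub>G\<^esub> k' \<otimes>\<^bsub>G\<^esub> c_pow f'" by blast
    then have "x \<otimes>\<^bsub>G\<^esub> y = a [^]\<^bsub>G\<^esub> (k + k') \<otimes>\<^bsub>G\<^esub> c_pow (f \<noteq> f')" by (simp add: x mult)
    then show "x \<otimes>\<^bsub>G\<^esub> y \<in> ?K" by blast
  qed auto
  moreover have "a = a [^]\<^bsub>G\<^esub> (1 :: int) \<otimes>\<^bsub>G\<^esub> c_pow False" "c = a [^]\<^bsub>G\<^esub> (0 :: int) \<otimes>\<^bsub>G\<^esub> c_pow True"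
    by (simp_all add: c_pow_def)
  then have "{a, c} \<subseteq> ?K" by blast
  ultimately show "generate G {a, c} \<subseteq> ?K" by (intro generate_subgroup_incl)
  have sub: "subgroup (generate G {a, c}) G" by (rule generate_is_subgroup) auto
  show "?K \<subseteq> generate G {a, c}"
    using subgroup_int_pow_closed[OF sub] subgroup.m_closed[OF sub] subgroup.one_closed[OF sub]
    by (auto simp: c_pow_def generate.incl)
qed

lemma Lambda0_eq:
  "Lambda0 R = {\<lambda>X\<in>carrier (bol_loop n R). X #>\<^bsub>G\<^esub> (a [^]\<^bsub>G\<^esub> k \<otimes>\<^bsub>G\<^esub> c_pow f) | (k :: int) f. True}"
  by (auto simp: Lambda0_def generate_a_c coset_action_def bol_loop_def)

lemma pt_translate: "pt k f #>\<^bsub>G\<^esub> (a [^]\<^bsub>G\<^esub> (j :: int) \<otimes>\<^bsub>G\<^esub> c_pow g) = pt (k + j) (f \<noteq> g)"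
proof -
  have "pt k f \<subseteq> carrier G"
    by (simp add: pt_def r_coset_subset_G H_subset)
  then have "pt k f #>\<^bsub>G\<^esub> (a [^]\<^bsub>G\<^esub> j \<otimes>\<^bsub>G\<^esub> c_pow g) = pt k f #>\<^bsub>G\<^esub> a [^]\<^bsub>G\<^esub> j #>\<^bsub>G\<^esub> c_pow g"
    by (simp add: coset_mult_assoc)
  then show ?thesis by (simp only: pt_mult_a pt_mult_c)
qed

end

section \<open>Permutations acting on the right\<close>

lemma (in group) conjugate_mult:
  assumes "x \<in> carrier G" "y \<in> carrier G" "s \<in> carrier G"
  shows "conjugate G (x \<otimes> y) s = conjugate G x s \<otimes> conjugate G y s"
  using assms by (simp add: conjugate_def m_assoc) (simp flip: m_assoc)

lemma (in group) conjugate_inv: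
  assumes "x \<in> carrier G" "s \<in> carrier G"
  shows "conjugate G (inv x) s = inv (conjugate G x s)"
  using assms by (simp add: conjugate_def m_assoc inv_mult_group)

lemma Sym_carrier [simp]: "carrier (Sym X) = Bij X"
  and Sym_mult: "u \<otimes>\<^bsub>Sym X\<^esub> v = compose X v u"
  and Sym_one: "\<one>\<^bsub>Sym X\<^esub> = (\<lambda>x\<in>X. x)"
  by (simp_all add: Sym_def)

lemma Sym_mult_apply: "x \<in> X \<Longrightarrow> (u \<otimes>\<^bsub>Sym X\<^esub> v) x = v (u x)"
  by (simp add: Sym_mult compose_def)

lemma Bij_closed: "u \<in> Bij X \<Longrightarrow> x \<in> X \<Longrightarrow> u x \<in> X"
  using Bij_imp_funcset by fast

lemma group_Sym: "group (Sym X)"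
proof (rule groupI)
  fix u v w assume "u \<in> carrier (Sym X)" "v \<in> carrier (Sym X)" "w \<in> carrier (Sym X)"
  then show "u \<otimes>\<^bsub>Sym X\<^esub> v \<otimes>\<^bsub>Sym X\<^esub> w = u \<otimes>\<^bsub>Sym X\<^esub> (v \<otimes>\<^bsub>Sym X\<^esub> w)"
    by (simp add: Sym_mult compose_assoc[OF Bij_imp_funcset])
next
  fix u assume "u \<in> carrier (Sym X)"
  then have u: "u \<in> Bij X" by simp
  let ?v = "restrict (inv_into X u) X"
  have "?v \<otimes>\<^bsub>Sym X\<^esub> u = \<one>\<^bsub>Sym X\<^esub>"
    using u by (auto simp: Sym_mult Sym_one Bij_def bij_betw_def compose_inv_into_id compose_def
        f_inv_into_f intro!: ext)
  with u show "\<exists>v\<in>carrier (Sym X). v \<otimes>\<^bsub>Sym X\<^esub> u = \<one>\<^bsub>Sym X\<^esub>"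
    using restrict_inv_into_Bij by auto
  show "\<one>\<^bsub>Sym X\<^esub> \<otimes>\<^bsub>Sym X\<^esub> u = u"
    using u by (simp add: Sym_mult Sym_one compose_Id[OF Bij_imp_funcset] Bij_imp_extensional)
qed (simp_all add: Sym_mult Sym_one compose_Bij id_Bij)

lemma Sym_inv_apply:
  assumes "u \<in> Bij X" "x \<in> X"
  shows "u ((inv\<^bsub>Sym X\<^esub> u) x) = x" "(inv\<^bsub>Sym X\<^esub> u) (u x) = x"
proof -
  interpret group "Sym X" by (rule group_Sym)
  have "(inv\<^bsub>Sym X\<^esub> u \<otimes>\<^bsub>Sym X\<^esub> u) x = x" "(u \<otimes>\<^bsub>Sym X\<^esub> inv\<^bsub>Sym X\<^esub> u) x = x"
    using assms by (simp_all add: Sym_one)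
  then show "u ((inv\<^bsub>Sym X\<^esub> u) x) = x" "(inv\<^bsub>Sym X\<^esub> u) (u x) = x"
    using assms by (simp_all only: Sym_mult_apply)
qed

lemma Sym_inv_closed: "u \<in> Bij X \<Longrightarrow> inv\<^bsub>Sym X\<^esub> u \<in> Bij X"
  using group.inv_closed[OF group_Sym, of u X] by simp

lemma Sym_mult_closed: "u \<in> Bij X \<Longrightarrow> v \<in> Bij X \<Longrightarrow> u \<otimes>\<^bsub>Sym X\<^esub> v \<in> Bij X"
  by (simp add: Sym_mult compose_Bij)

lemma Bij_withI:
  assumes "u \<in> extensional X" "\<And>x. x \<in> X \<Longrightarrow> u x \<in> X"
    and "\<And>x. x \<in> X \<Longrightarrow> v x \<in> X" "\<And>x. x \<in> X \<Longrightarrow> v (u x) = x" "\<And>x. x \<in> X \<Longrightarrow> u (v x) = x"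
  shows "u \<in> Bij X"
  using assms by (auto simp: Bij_def intro!: bij_betw_byWitness[where f' = v])

section \<open>The collineations of the net of a loop\<close>

text \<open>Divisibility on both sides is expressed by the bijectivity of the translations, because
  \<^const>\<open>p_map\<close> inverts them in the symmetric group.\<close>

locale loop =
  fixes L :: "('a, 'm) monoid_scheme" (structure)
  assumes mult_closed [simp, intro]: "x \<in> carrier L \<Longrightarrow> y \<in> carrier L \<Longrightarrow> x \<otimes> y \<in> carrier L"
    and unit_closed [simp, intro]: "\<one> \<in> carrier L"
    and left_unit [simp]: "x \<in> carrier L \<Longrightarrow> \<one> \<otimes> x = x"
    and right_unit [simp]: "x \<in> carrier L \<Longrightarrow> x \<otimes> \<one> = x"
    and left_mult_Bij [simp]: "x \<in> carrier L \<Longrightarrow> left_mult L x \<in> Bij (carrier L)"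
    and right_mult_Bij [simp]: "x \<in> carrier L \<Longrightarrow> right_mult L x \<in> Bij (carrier L)"
begin

lemma left_cancel:
  "x \<in> carrier L \<Longrightarrow> y \<in> carrier L \<Longrightarrow> z \<in> carrier L \<Longrightarrow> x \<otimes> y = x \<otimes> z \<Longrightarrow> y = z"
  using left_mult_Bij[of x] by (auto simp: left_mult_def Bij_def bij_betw_def inj_on_def)

text \<open>The permutation \<open>w\<close> of the transversal lines that belongs to \<open>(u, v)\<close> need not be named: taking \<open>x = \<one>\<close> in \<open>u x \<otimes> v y = w (x \<otimes> y)\<close> gives \<open>w y = u \<one> \<otimes> v y\<close>.\<close>

definition is_coll :: "('a \<Rightarrow> 'a) \<Rightarrow> ('a \<Rightarrow> 'a) \<Rightarrow> bool" where
  "is_coll u v \<longleftrightarrow> u \<in> Bij (carrier L) \<and> v \<in> Bij (carrier L) \<and>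
    (\<forall>x\<in>carrier L. \<forall>y\<in>carrier L. u x \<otimes> v y = u \<one> \<otimes> v (x \<otimes> y))"

lemma is_collD:
  assumes "is_coll u v"
  shows "u \<in> Bij (carrier L)" "v \<in> Bij (carrier L)"
    "x \<in> carrier L \<Longrightarrow> y \<in> carrier L \<Longrightarrow> u x \<otimes> v y = u \<one> \<otimes> v (x \<otimes> y)"
  using assms unfolding is_coll_def by blast+

lemma coll_apply: "x \<in> carrier L \<Longrightarrow> y \<in> carrier L \<Longrightarrow> coll L u v (x, y) = (u x, v y)"
  by (simp add: coll_def)

lemma coll_eq_iff:
  assumes "u \<in> Bij (carrier L)" "v \<in> Bij (carrier L)" "u' \<in> Bij (carrier L)" "v' \<in> Bij (carrier L)"
  shows "coll L u v = coll L u' v' \<longleftrightarrow> u = u' \<and> v = v'"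
proof
  assume eq: "coll L u v = coll L u' v'"
  have "(u x, v x) = (u' x, v' x)" if "x \<in> carrier L" for x
    using that fun_cong[OF eq, of "(x, x)"] by (simp add: coll_apply)
  then show "u = u' \<and> v = v'"
    using assms[THEN Bij_imp_extensional] by (auto intro!: extensionalityI[where A = "carrier L"])
qed simp

lemma coll_Bij:
  assumes u: "u \<in> Bij (carrier L)" and v: "v \<in> Bij (carrier L)"
  shows "coll L u v \<in> Bij (carrier L \<times> carrier L)"
proof (rule Bij_withI)
  let ?u = "inv\<^bsub>Sym (carrier L)\<^esub> u" and ?v = "inv\<^bsub>Sym (carrier L)\<^esub> v"
  show "coll L u v \<in> extensional (carrier L \<times> carrier L)"
    by (simp add: coll_def)
  fix p assume "p \<in> carrier L \<times> carrier L"
  then obtain x y where "p = (x, y)" "x \<in> carrier L" "y \<in> carrier L" by blast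
  then show "coll L u v p \<in> carrier L \<times> carrier L"
    "coll L ?u ?v p \<in> carrier L \<times> carrier L"
    "coll L ?u ?v (coll L u v p) = p" "coll L u v (coll L ?u ?v p) = p"
    using u v by (simp_all add: coll_apply Bij_closed Sym_inv_closed Sym_inv_apply)
qed

lemma coll_mult:
  assumes "u \<in> Bij (carrier L)" "v \<in> Bij (carrier L)"
  shows "compose (carrier L \<times> carrier L) (coll L u' v') (coll L u v) =
    coll L (u \<otimes>\<^bsub>Sym (carrier L)\<^esub> u') (v \<otimes>\<^bsub>Sym (carrier L)\<^esub> v')"
  using assms
  by (intro extensionalityI[where A = "carrier L \<times> carrier L"])
    (auto simp: compose_def coll_def Sym_mult Bij_closed)

text \<open>Each of the three line classes is indexed by the loop, and \<open>coll L u v\<close> permutes the indices by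
  \<open>u\<close>, \<open>v\<close> and \<open>w\<close> respectively.\<close>

lemma coll_in_collineations:
  assumes "is_coll u v"
  shows "coll L u v \<in> collineations L"
proof -
  note uv = is_collD[OF assms]
  let ?f = "coll L u v" and ?w = "\<lambda>z. u \<one> \<otimes> v z"
  let ?V = "\<lambda>x. {(x, y) | y. y \<in> carrier L}" and ?H = "\<lambda>y. {(x, y) | x. x \<in> carrier L}"
  let ?T = "\<lambda>c. {(x, y) | x y. x \<in> carrier L \<and> y \<in> carrier L \<and> x \<otimes> y = c}"
  have onto: "u ` carrier L = carrier L" "v ` carrier L = carrier L"
    using uv(1,2) by (auto simp: Bij_def bij_betw_def)
  have w_onto: "?w ` carrier L = carrier L"
  proof -
    have "?w ` carrier L = left_mult L (u \<one>) ` v ` carrier L"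
      using uv(1,2) by (auto simp: left_mult_def Bij_closed image_image)
    also have "\<dots> = carrier L"
      using onto left_mult_Bij[of "u \<one>"] uv(1) by (simp add: Bij_def bij_betw_def Bij_closed)
    finally show ?thesis .
  qed
  have w_inj: "z = z'" if "?w z = ?w z'" "z \<in> carrier L" "z' \<in> carrier L" for z z'
  proof -
    have "v z = v z'" by (rule left_cancel[of "u \<one>" "v z" "v z'"]) (use that uv(1,2) in \<open>simp_all add: Bij_closed\<close>)
    then show ?thesis using that uv(2) by (auto simp: Bij_def bij_betw_def inj_on_def)
  qed
  have V: "?f ` ?V x = ?V (u x)" if "x \<in> carrier L" for x
  proof -
    have "?f ` ?V x = (\<lambda>y. (u x, v y)) ` carrier L"
      using that by (force simp: coll_apply)
    also have "\<dots> = Pair (u x) ` v ` carrier L" by (simp add: image_image)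
    finally show ?thesis using onto by auto
  qed
  have H: "?f ` ?H y = ?H (v y)" if "y \<in> carrier L" for y
  proof -
    have "?f ` ?H y = (\<lambda>x. (u x, v y)) ` carrier L"
      using that by (force simp: coll_apply)
    also have "\<dots> = (\<lambda>x'. (x', v y)) ` u ` carrier L" by (simp add: image_image)
    finally show ?thesis using onto by auto
  qed
  have T: "?f ` ?T c = ?T (?w c)" if "c \<in> carrier L" for c
  proof
    show "?f ` ?T c \<subseteq> ?T (?w c)"
    proof
      fix p assume "p \<in> ?f ` ?T c"
      then obtain x y where "p = (u x, v y)" "x \<in> carrier L" "y \<in> carrier L" "x \<otimes> y = c"
        by (auto simp: coll_apply)
      then show "p \<in> ?T (?w c)" using uv(1,2) uv(3)[of x y] by (auto simp: Bij_closed)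
    qed
    show "?T (?w c) \<subseteq> ?f ` ?T c"
    proof
      fix p assume "p \<in> ?T (?w c)"
      then obtain x y where "p = (u x, v y)" "x \<in> carrier L" "y \<in> carrier L" "u x \<otimes> v y = ?w c"
        using onto by (smt (verit, best) image_iff mem_Collect_eq)
      moreover from this have "x \<otimes> y = c"
        using uv(3)[of x y] that by (simp add: w_inj)
      ultimately show "p \<in> ?f ` ?T c"
        by (auto intro!: image_eqI[of _ _ "(x, y)"] simp: coll_apply)
    qed
  qed
  have lines: "(`) ?f ` {F x | x. x \<in> carrier L} = {F x | x. x \<in> carrier L}"
    if "\<And>x. x \<in> carrier L \<Longrightarrow> ?f ` F x = F (g x)" "g ` carrier L = carrier L"
    for F :: "'a \<Rightarrow> ('a \<times> 'a) set" and g
  proof -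
    have "(`) ?f ` {F x | x. x \<in> carrier L} = (\<lambda>x. ?f ` F x) ` carrier L"
      by auto
    also have "\<dots> = F ` g ` carrier L" using that(1) by (auto simp: image_image)
    finally show ?thesis using that(2) by auto
  qed
  have "(`) ?f ` vertical_lines L = vertical_lines L"
    unfolding vertical_lines_def by (rule lines, erule V, rule onto)
  moreover have "(`) ?f ` horizontal_lines L = horizontal_lines L"
    unfolding horizontal_lines_def by (rule lines, erule H, rule onto)
  moreover have "(`) ?f ` transversal_lines L = transversal_lines L"
    unfolding transversal_lines_def by (rule lines[where ?g1 = ?w], erule T, rule w_onto)
  ultimately show ?thesis
    using coll_Bij uv(1,2) by (simp add: collineations_def)
qed

text \<open>Preservation of vertical lines makes the first coordinate of \<open>f (x, y)\<close> a function of \<open>x\<close>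
  alone, and likewise for horizontal lines.  The points \<open>(x, y)\<close> and \<open>(\<one>, x \<otimes> y)\<close> lie on a common
  transversal line, and comparing the products of their images gives the identity in \<open>is_coll\<close>.\<close>

lemma collineation_is_coll:
  assumes "f \<in> collineations L"
  obtains u v where "is_coll u v" "f = coll L u v"
proof
  let ?C = "carrier L"
  define u where "u = (\<lambda>x\<in>?C. fst (f (x, \<one>)))"
  define v where "v = (\<lambda>y\<in>?C. snd (f (\<one>, y)))"
  have f: "f \<in> Bij (?C \<times> ?C)" using assms by (simp add: collineations_def)
  have line: "\<exists>l'\<in>S. f ` l \<subseteq> l'" if "(`) f ` S = S" "l \<in> S" for S l
    using that by blast
  have f_eq: "f (x, y) = (u x, v y)" if "x \<in> ?C" "y \<in> ?C" for x y
  proof -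
    have "{(x, y) | y. y \<in> ?C} \<in> vertical_lines L"
      using that by (auto simp: vertical_lines_def)
    then have "\<exists>l'\<in>vertical_lines L. f ` {(x, y) | y. y \<in> ?C} \<subseteq> l'"
      using assms by (intro line) (simp_all add: collineations_def)
    then obtain x' where x': "f ` {(x, y) | y. y \<in> ?C} \<subseteq> {(x', y) | y. y \<in> ?C}"
      by (auto simp: vertical_lines_def)
    have "fst (f p) = x'" if "p \<in> {(x, y) | y. y \<in> ?C}" for p
      using subsetD[OF x' imageI[OF that]] by auto
    then have 1: "fst (f (x, y)) = u x"
      using that by (simp add: u_def)
    have "{(x, y) | x. x \<in> ?C} \<in> horizontal_lines L"
      using that by (auto simp: horizontal_lines_def)
    then have "\<exists>l'\<in>horizontal_lines L. f ` {(x, y) | x. x \<in> ?C} \<subseteq> l'"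
      using assms by (intro line) (simp_all add: collineations_def)
    then obtain y' where y': "f ` {(x, y) | x. x \<in> ?C} \<subseteq> {(x, y') | x. x \<in> ?C}"
      by (auto simp: horizontal_lines_def)
    have "snd (f p) = y'" if "p \<in> {(x, y) | x. x \<in> ?C}" for p
      using subsetD[OF y' imageI[OF that]] by auto
    then have 2: "snd (f (x, y)) = v y"
      using that by (simp add: v_def)
    from 1 2 show ?thesis by (simp add: prod_eq_iff)
  qed
  have f_inj: "p = q" if "f p = f q" "p \<in> ?C \<times> ?C" "q \<in> ?C \<times> ?C" for p q
    using that f by (auto simp: Bij_def bij_betw_def inj_on_def)
  have f_onto: "\<exists>x\<in>?C. \<exists>y\<in>?C. u x = x' \<and> v y = y'" if "x' \<in> ?C" "y' \<in> ?C" for x' y'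
  proof -
    have "(x', y') \<in> f ` (?C \<times> ?C)" using that f by (simp add: Bij_def bij_betw_def)
    then show ?thesis using f_eq by auto
  qed
  have closed: "u x \<in> ?C" "v x \<in> ?C" if "x \<in> ?C" for x
    using Bij_closed[OF f, of "(x, x)"] f_eq[of x x] that by auto
  have "u \<in> Bij ?C"
  proof -
    have "inj_on u ?C"
    proof (rule inj_onI)
      fix x x' assume "x \<in> ?C" "x' \<in> ?C" "u x = u x'"
      then show "x = x'" using f_inj[of "(x, \<one>)" "(x', \<one>)"] by (simp add: f_eq)
    qed
    moreover have "u ` ?C = ?C"
    proof
      show "u ` ?C \<subseteq> ?C" using closed by auto
      show "?C \<subseteq> u ` ?C" using f_onto[OF _ unit_closed] f_onto[OF unit_closed] by blast
    qed
    ultimately show ?thesis by (simp add: Bij_def bij_betw_def u_def)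
  qed
  moreover have "v \<in> Bij ?C"
  proof -
    have "inj_on v ?C"
    proof (rule inj_onI)
      fix x x' assume "x \<in> ?C" "x' \<in> ?C" "v x = v x'"
      then show "x = x'" using f_inj[of "(\<one>, x)" "(\<one>, x')"] by (simp add: f_eq)
    qed
    moreover have "v ` ?C = ?C"
    proof
      show "v ` ?C \<subseteq> ?C" using closed by auto
      show "?C \<subseteq> v ` ?C" using f_onto[OF _ unit_closed] f_onto[OF unit_closed] by blast
    qed
    ultimately show ?thesis by (simp add: Bij_def bij_betw_def v_def)
  qed
  moreover have "u x \<otimes> v y = u \<one> \<otimes> v (x \<otimes> y)" if "x \<in> ?C" "y \<in> ?C" for x y
  proof -
    let ?T = "\<lambda>c. {(x, y) | x y. x \<in> ?C \<and> y \<in> ?C \<and> x \<otimes> y = c}"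
    have "?T (x \<otimes> y) \<in> transversal_lines L"
      using that by (auto simp: transversal_lines_def)
    then have "\<exists>l'\<in>transversal_lines L. f ` ?T (x \<otimes> y) \<subseteq> l'"
      using assms by (intro line) (simp_all add: collineations_def)
    then obtain c where c: "f ` ?T (x \<otimes> y) \<subseteq> ?T c"
      by (auto simp: transversal_lines_def)
    have "fst (f p) \<otimes> snd (f p) = c" if "p \<in> ?T (x \<otimes> y)" for p
      using subsetD[OF c imageI[OF that]] by auto
    from this[of "(x, y)"] this[of "(\<one>, x \<otimes> y)"] show ?thesis
      using that by (simp add: f_eq)
  qed
  ultimately show "is_coll u v" unfolding is_coll_def by blast
  show "f = coll L u v"
    using f[THEN Bij_imp_extensional] f_eq
    by (intro extensionalityI[where A = "?C \<times> ?C"]) (auto simp: coll_def)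
qed

lemma is_collI:
  assumes "u \<in> Bij (carrier L)" "v \<in> Bij (carrier L)"
    and "\<And>x y. x \<in> carrier L \<Longrightarrow> y \<in> carrier L \<Longrightarrow> u x \<otimes> v y = w (x \<otimes> y)"
  shows "is_coll u v"
  unfolding is_coll_def
proof (intro conjI ballI assms(1,2))
  fix x y assume "x \<in> carrier L" "y \<in> carrier L"
  then show "u x \<otimes> v y = u \<one> \<otimes> v (x \<otimes> y)"
    using assms(3)[of x y] assms(3)[of \<one> "x \<otimes> y"] by simp
qed

abbreviation \<Gamma> where "\<Gamma> \<equiv> collineation_group L"
abbreviation S where "S \<equiv> Sym (carrier L)"

lemma \<Gamma>_mult: "f \<otimes>\<^bsub>\<Gamma>\<^esub> g = f \<otimes>\<^bsub>Sym (carrier L \<times> carrier L)\<^esub> g"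
  and \<Gamma>_one: "\<one>\<^bsub>\<Gamma>\<^esub> = \<one>\<^bsub>Sym (carrier L \<times> carrier L)\<^esub>"
  by (simp_all add: collineation_group_def Sym_def)

lemma \<Gamma>_carrier: "carrier \<Gamma> = {coll L u v | u v. is_coll u v}"
proof -
  have "carrier \<Gamma> = collineations L" by (simp add: collineation_group_def)
  also have "\<dots> = {coll L u v | u v. is_coll u v}"
    using coll_in_collineations collineation_is_coll by blast
  finally show ?thesis .
qed

lemma coll_in_\<Gamma>: "is_coll u v \<Longrightarrow> coll L u v \<in> carrier \<Gamma>"
  by (auto simp: \<Gamma>_carrier)

lemma coll_mult_\<Gamma>:
  assumes "u \<in> Bij (carrier L)" "v \<in> Bij (carrier L)"
  shows "coll L u v \<otimes>\<^bsub>\<Gamma>\<^esub> coll L u' v' = coll L (u \<otimes>\<^bsub>S\<^esub> u') (v \<otimes>\<^bsub>S\<^esub> v')"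
  unfolding \<Gamma>_mult by (simp add: Sym_mult[where X = "carrier L \<times> carrier L"] coll_mult[OF assms])

lemma \<Gamma>_apply: "p \<in> carrier L \<times> carrier L \<Longrightarrow> (f \<otimes>\<^bsub>\<Gamma>\<^esub> g) p = g (f p)"
  by (simp only: \<Gamma>_mult Sym_mult_apply)

lemma coll_one: "coll L \<one>\<^bsub>S\<^esub> \<one>\<^bsub>S\<^esub> = \<one>\<^bsub>\<Gamma>\<^esub>"
  by (auto simp: \<Gamma>_one Sym_one coll_def)

lemma is_coll_one: "is_coll \<one>\<^bsub>S\<^esub> \<one>\<^bsub>S\<^esub>"
  by (rule is_collI[where w = "\<lambda>z. z"]) (simp_all add: Sym_one id_Bij)

lemma is_coll_mult:
  assumes "is_coll u v" "is_coll u' v'"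
  shows "is_coll (u \<otimes>\<^bsub>S\<^esub> u') (v \<otimes>\<^bsub>S\<^esub> v')"
proof (rule is_collI[where w = "\<lambda>z. u' \<one> \<otimes> v' (u \<one> \<otimes> v z)"])
  note uv = is_collD[OF assms(1)] and uv' = is_collD[OF assms(2)]
  fix x y assume "x \<in> carrier L" "y \<in> carrier L"
  then show "(u \<otimes>\<^bsub>S\<^esub> u') x \<otimes> (v \<otimes>\<^bsub>S\<^esub> v') y = u' \<one> \<otimes> v' (u \<one> \<otimes> v (x \<otimes> y))"
    using uv'(3)[of "u x" "v y"] uv(3)[of x y] uv(1,2) by (simp add: Sym_mult_apply Bij_closed)
qed (use assms[THEN is_collD(1)] assms[THEN is_collD(2)] in \<open>simp_all add: Sym_mult_closed\<close>)

lemma is_coll_inv: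
  assumes "is_coll u v"
  shows "is_coll (inv\<^bsub>S\<^esub> u) (inv\<^bsub>S\<^esub> v)"
  unfolding is_coll_def
proof (intro conjI ballI)
  note uv = is_collD[OF assms]
  let ?u = "inv\<^bsub>S\<^esub> u" and ?v = "inv\<^bsub>S\<^esub> v"
  show u': "?u \<in> Bij (carrier L)" and v': "?v \<in> Bij (carrier L)"
    using uv(1,2) by (simp_all add: Sym_inv_closed)
  fix x y assume xy: "x \<in> carrier L" "y \<in> carrier L"
  have "u \<one> \<otimes> v (?u x \<otimes> ?v y) = x \<otimes> y"
    using xy uv(1,2) u' v' uv(3)[of "?u x" "?v y"] by (simp add: Bij_closed Sym_inv_apply)
  also have "x \<otimes> y = u \<one> \<otimes> v (?u \<one> \<otimes> ?v (x \<otimes> y))"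
    using xy uv(1,2) u' v' uv(3)[of "?u \<one>" "?v (x \<otimes> y)"] by (simp add: Bij_closed Sym_inv_apply)
  finally have "v (?u x \<otimes> ?v y) = v (?u \<one> \<otimes> ?v (x \<otimes> y))"
    by (rule left_cancel[rotated -1]) (use xy uv(1,2) u' v' in \<open>simp_all add: Bij_closed\<close>)
  then have "?v (v (?u x \<otimes> ?v y)) = ?v (v (?u \<one> \<otimes> ?v (x \<otimes> y)))" by simp
  then show "?u x \<otimes> ?v y = ?u \<one> \<otimes> ?v (x \<otimes> y)"
    using xy uv(1,2) u' v' by (simp add: Bij_closed Sym_inv_apply)
qed

lemma group_\<Gamma>: "group \<Gamma>"
proof -
  let ?P = "Sym (carrier L \<times> carrier L)"
  interpret P: group ?P by (rule group_Sym)
  have car: "collineations L = {coll L u v | u v. is_coll u v}"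
    using \<Gamma>_carrier by (simp add: collineation_group_def)
  have "subgroup (collineations L) ?P"
  proof (rule P.subgroupI)
    show "collineations L \<subseteq> carrier ?P"
      by (auto simp: collineations_def)
    show "collineations L \<noteq> {}" using is_coll_one by (auto simp: car)
    fix f assume "f \<in> collineations L"
    then obtain u v where f: "f = coll L u v" "is_coll u v" by (rule collineation_is_coll)
    then have uv: "u \<in> Bij (carrier L)" "v \<in> Bij (carrier L)" by (auto dest: is_collD(1,2))
    interpret S: group S by (rule group_Sym)
    have "coll L (inv\<^bsub>S\<^esub> u) (inv\<^bsub>S\<^esub> v) \<otimes>\<^bsub>\<Gamma>\<^esub> f = \<one>\<^bsub>\<Gamma>\<^esub>"
      using uv by (simp add: f coll_mult_\<Gamma> Sym_inv_closed coll_one)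
    then have "inv\<^bsub>?P\<^esub> f = coll L (inv\<^bsub>S\<^esub> u) (inv\<^bsub>S\<^esub> v)"
      unfolding \<Gamma>_mult \<Gamma>_one
      using uv by (intro P.inv_equality) (simp_all add: f coll_Bij Sym_inv_closed)
    then show "inv\<^bsub>?P\<^esub> f \<in> collineations L"
      using f is_coll_inv by (simp add: coll_in_collineations)
    fix g assume "g \<in> collineations L"
    then obtain u' v' where g: "g = coll L u' v'" "is_coll u' v'" by (rule collineation_is_coll)
    have "f \<otimes>\<^bsub>?P\<^esub> g = coll L (u \<otimes>\<^bsub>S\<^esub> u') (v \<otimes>\<^bsub>S\<^esub> v')"
      using uv by (simp add: f g coll_mult_\<Gamma> flip: \<Gamma>_mult)
    then show "f \<otimes>\<^bsub>?P\<^esub> g \<in> collineations L"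
      using f(2) g(2) by (simp add: is_coll_mult coll_in_collineations)
  qed
  then show ?thesis
    by (simp add: collineation_group_def P.subgroup_imp_group)
qed

sublocale \<Gamma>: group \<Gamma> by (rule group_\<Gamma>)
sublocale S: group S by (rule group_Sym)

lemma inv_coll:
  assumes "is_coll u v"
  shows "inv\<^bsub>\<Gamma>\<^esub> (coll L u v) = coll L (inv\<^bsub>S\<^esub> u) (inv\<^bsub>S\<^esub> v)"
proof (rule \<Gamma>.inv_equality)
  note uv = is_collD(1,2)[OF assms]
  show "coll L (inv\<^bsub>S\<^esub> u) (inv\<^bsub>S\<^esub> v) \<otimes>\<^bsub>\<Gamma>\<^esub> coll L u v = \<one>\<^bsub>\<Gamma>\<^esub>"
    using uv by (simp add: coll_mult_\<Gamma> Sym_inv_closed coll_one)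
qed (use assms is_coll_inv in \<open>simp_all add: coll_in_\<Gamma>\<close>)

lemma inv_apply:
  assumes "f \<in> carrier \<Gamma>" "p \<in> carrier L \<times> carrier L"
  shows "(inv\<^bsub>\<Gamma>\<^esub> f) (f p) = p"
proof -
  have "(f \<otimes>\<^bsub>\<Gamma>\<^esub> inv\<^bsub>\<Gamma>\<^esub> f) p = p" using assms by (simp add: \<Gamma>_one Sym_one)
  then show ?thesis by (simp only: \<Gamma>_apply[OF assms(2)])
qed

section \<open>Automorphisms as collineations\<close>

lemma autoD:
  assumes "\<sigma> \<in> auto L"
  shows "\<sigma> \<in> Bij (carrier L)"
    and "\<And>x y. x \<in> carrier L \<Longrightarrow> y \<in> carrier L \<Longrightarrow> \<sigma> (x \<otimes> y) = \<sigma> x \<otimes> \<sigma> y"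
  using assms by (auto simp: auto_def hom_def)

lemma auto_one:
  assumes "\<sigma> \<in> auto L"
  shows "\<sigma> \<one> = \<one>"
proof -
  have "\<sigma> \<one> \<otimes> \<sigma> \<one> = \<sigma> \<one> \<otimes> \<one>"
    using autoD(2)[OF assms, of \<one> \<one>] autoD(1)[OF assms] by (simp add: Bij_closed)
  then show ?thesis
    by (rule left_cancel[rotated -1]) (use autoD(1)[OF assms] in \<open>simp_all add: Bij_closed\<close>)
qed

lemma auto_is_coll: "\<sigma> \<in> auto L \<Longrightarrow> is_coll \<sigma> \<sigma>"
  by (rule is_collI[where w = \<sigma>]) (simp_all add: autoD)

definition Aut_colls where "Aut_colls = (\<lambda>\<sigma>. coll L \<sigma> \<sigma>) ` auto L"

text \<open>If \<open>u\<close> and \<open>v\<close> fix \<open>\<one>\<close>, the identity \<open>u x \<otimes> v y = v (x \<otimes> y)\<close> with \<open>y = \<one>\<close> yields \<open>u = v\<close>.\<close>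

lemma auto_eq_stabilizer:
  "Aut_colls = {f \<in> carrier \<Gamma>. f (\<one>, \<one>) = (\<one>, \<one>)}"
proof
  show "Aut_colls \<subseteq> {f \<in> carrier \<Gamma>. f (\<one>, \<one>) = (\<one>, \<one>)}"
    by (auto simp: Aut_colls_def coll_in_\<Gamma> auto_is_coll auto_one coll_apply)
  show "{f \<in> carrier \<Gamma>. f (\<one>, \<one>) = (\<one>, \<one>)} \<subseteq> Aut_colls"
  proof
    fix f assume "f \<in> {f \<in> carrier \<Gamma>. f (\<one>, \<one>) = (\<one>, \<one>)}"
    then obtain u v where f: "f = coll L u v" and uv: "is_coll u v" and 1: "u \<one> = \<one>" "v \<one> = \<one>"
      by (auto simp: \<Gamma>_carrier coll_apply)
    note B = is_collD(1,2)[OF uv]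
    have mult: "u x \<otimes> v y = v (x \<otimes> y)" if "x \<in> carrier L" "y \<in> carrier L" for x y
      using is_collD(3)[OF uv that] that B by (simp add: 1 Bij_closed)
    have eq: "u x = v x" if "x \<in> carrier L" for x
      using mult[OF that unit_closed] that B by (simp add: 1 Bij_closed)
    then have "u = v" using B by (auto intro!: extensionalityI[where A = "carrier L"] Bij_imp_extensional)
    moreover have "v \<in> auto L"
      using B mult eq by (auto simp: auto_def hom_def Bij_closed)
    ultimately show "f \<in> Aut_colls" by (auto simp: f Aut_colls_def)
  qed
qed

lemma Aut_collsI: "f \<in> carrier \<Gamma> \<Longrightarrow> f (\<one>, \<one>) = (\<one>, \<one>) \<Longrightarrow> f \<in> Aut_colls"
  and Aut_colls_apply: "f \<in> Aut_colls \<Longrightarrow> f (\<one>, \<one>) = (\<one>, \<one>)"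
  by (simp_all add: auto_eq_stabilizer)

lemma subgroup_Aut_colls: "subgroup Aut_colls \<Gamma>"
proof (rule \<Gamma>.subgroupI)
  show "Aut_colls \<subseteq> carrier \<Gamma>" "Aut_colls \<noteq> {}"
    using \<Gamma>.one_closed by (auto simp: auto_eq_stabilizer \<Gamma>_one Sym_one)
  fix f assume "f \<in> Aut_colls"
  then have f: "f \<in> carrier \<Gamma>" "f (\<one>, \<one>) = (\<one>, \<one>)" by (auto simp: auto_eq_stabilizer)
  then show "inv\<^bsub>\<Gamma>\<^esub> f \<in> Aut_colls"
    using inv_apply[OF f(1), of "(\<one>, \<one>)"] by (simp add: auto_eq_stabilizer)
  fix g assume "g \<in> Aut_colls"
  with f show "f \<otimes>\<^bsub>\<Gamma>\<^esub> g \<in> Aut_colls"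
    by (simp add: auto_eq_stabilizer \<Gamma>_apply)
qed

text \<open>Transitivity of \<open>M\<close> on the orbit writes each collineation as an element of \<open>M\<close> times one of the
  stabilizer; normality of \<open>M\<close> then follows from its invariance under the stabilizer alone.\<close>

lemma semidirect_product_if_regular_orbit:
  assumes M: "subgroup M \<Gamma>"
    and orbit: "\<And>f. f \<in> carrier \<Gamma> \<Longrightarrow> \<exists>m\<in>M. m (\<one>, \<one>) = f (\<one>, \<one>)"
    and free: "\<And>m. m \<in> M \<Longrightarrow> m (\<one>, \<one>) = (\<one>, \<one>) \<Longrightarrow> m = \<one>\<^bsub>\<Gamma>\<^esub>"
    and conj: "\<And>s m. s \<in> Aut_colls \<Longrightarrow> m \<in> M \<Longrightarrow> s \<otimes>\<^bsub>\<Gamma>\<^esub> m \<otimes>\<^bsub>\<Gamma>\<^esub> inv\<^bsub>\<Gamma>\<^esub> s \<in> M"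
  shows "is_semidirect_product \<Gamma> M Aut_colls"
proof -
  interpret M: subgroup M \<Gamma> by (rule M)
  interpret Aut_colls: subgroup Aut_colls \<Gamma> by (rule subgroup_Aut_colls)
  have factor: "\<exists>m\<in>M. \<exists>s\<in>Aut_colls. f = m \<otimes>\<^bsub>\<Gamma>\<^esub> s" if f: "f \<in> carrier \<Gamma>" for f
  proof -
    obtain m where m: "m \<in> M" "m (\<one>, \<one>) = f (\<one>, \<one>)" using orbit[OF f] by blast
    then have "(f \<otimes>\<^bsub>\<Gamma>\<^esub> inv\<^bsub>\<Gamma>\<^esub> m) (\<one>, \<one>) = (\<one>, \<one>)"
      using inv_apply[of m "(\<one>, \<one>)"] by (simp add: \<Gamma>_apply)
    then have s: "f \<otimes>\<^bsub>\<Gamma>\<^esub> inv\<^bsub>\<Gamma>\<^esub> m \<in> Aut_colls" (is "?s \<in> Aut_colls")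
      using f m by (intro Aut_collsI) simp_all
    have "?s \<otimes>\<^bsub>\<Gamma>\<^esub> m \<otimes>\<^bsub>\<Gamma>\<^esub> inv\<^bsub>\<Gamma>\<^esub> ?s \<in> M" using s m(1) by (rule conj)
    moreover have "f = (?s \<otimes>\<^bsub>\<Gamma>\<^esub> m \<otimes>\<^bsub>\<Gamma>\<^esub> inv\<^bsub>\<Gamma>\<^esub> ?s) \<otimes>\<^bsub>\<Gamma>\<^esub> ?s"
      using f m(1) by (simp add: \<Gamma>.m_assoc)
    ultimately show ?thesis using s by blast
  qed
  have "M \<lhd> \<Gamma>"
    unfolding \<Gamma>.normal_inv_iff
  proof (intro conjI ballI M)
    fix f m assume f: "f \<in> carrier \<Gamma>" and m: "m \<in> M"
    obtain m' s where ms: "m' \<in> M" "s \<in> Aut_colls" "f = m' \<otimes>\<^bsub>\<Gamma>\<^esub> s" using factor[OF f] by blast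
    have "m' \<otimes>\<^bsub>\<Gamma>\<^esub> (s \<otimes>\<^bsub>\<Gamma>\<^esub> m \<otimes>\<^bsub>\<Gamma>\<^esub> inv\<^bsub>\<Gamma>\<^esub> s) \<otimes>\<^bsub>\<Gamma>\<^esub> inv\<^bsub>\<Gamma>\<^esub> m' \<in> M"
      using ms m conj by blast
    then show "f \<otimes>\<^bsub>\<Gamma>\<^esub> m \<otimes>\<^bsub>\<Gamma>\<^esub> inv\<^bsub>\<Gamma>\<^esub> f \<in> M"
      using ms m by (simp add: \<Gamma>.m_assoc \<Gamma>.inv_mult_group)
  qed
  moreover have "M \<inter> Aut_colls = {\<one>\<^bsub>\<Gamma>\<^esub>}"
    using free Aut_colls_apply by auto
  moreover have "M <#>\<^bsub>\<Gamma>\<^esub> Aut_colls = carrier \<Gamma>"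
    using factor by (auto simp: set_mult_def)
  ultimately show ?thesis
    using subgroup_Aut_colls by (simp add: is_semidirect_product_def)
qed

lemma Aut_embedding:
  shows "(\<lambda>\<sigma>. coll L \<sigma> \<sigma>) \<in> hom (Aut L) \<Gamma>"
    and "inj_on (\<lambda>\<sigma>. coll L \<sigma> \<sigma>) (carrier (Aut L))"
    and "(\<lambda>\<sigma>. coll L \<sigma> \<sigma>) ` carrier (Aut L) = Aut_colls"
proof -
  have car: "carrier (Aut L) = auto L" and mult: "\<sigma> \<otimes>\<^bsub>Aut L\<^esub> \<tau> = \<sigma> \<otimes>\<^bsub>S\<^esub> \<tau>" for \<sigma> \<tau>
    by (simp_all add: Aut_def Sym_def)
  show "(\<lambda>\<sigma>. coll L \<sigma> \<sigma>) \<in> hom (Aut L) \<Gamma>"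
    by (rule homI) (simp_all add: car mult coll_in_\<Gamma> auto_is_coll coll_mult_\<Gamma> autoD(1))
  show "inj_on (\<lambda>\<sigma>. coll L \<sigma> \<sigma>) (carrier (Aut L))"
    by (rule inj_onI) (simp add: car coll_eq_iff autoD(1))
  show "(\<lambda>\<sigma>. coll L \<sigma> \<sigma>) ` carrier (Aut L) = Aut_colls"
    by (simp add: car Aut_colls_def)
qed

lemma conjugate_coll:
  assumes "\<sigma> \<in> auto L" "u \<in> Bij (carrier L)" "v \<in> Bij (carrier L)"
  shows "conjugate \<Gamma> (coll L u v) (coll L \<sigma> \<sigma>) = coll L (conjugate S u \<sigma>) (conjugate S v \<sigma>)"
  using assms
  by (simp add: conjugate_def inv_coll auto_is_coll coll_mult_\<Gamma> autoD(1) Sym_inv_closed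
      Sym_mult_closed)

lemma conjugate_left_mult:
  assumes "\<sigma> \<in> auto L" "x \<in> carrier L"
  shows "conjugate S (left_mult L x) \<sigma> = left_mult L (\<sigma> x)"
    and "conjugate S (right_mult L x) \<sigma> = right_mult L (\<sigma> x)"
proof -
  note s = autoD(1)[OF assms(1)]
  have "conjugate S (left_mult L x) \<sigma> y = left_mult L (\<sigma> x) y"
    "conjugate S (right_mult L x) \<sigma> y = right_mult L (\<sigma> x) y" if "y \<in> carrier L" for y
    using that assms s
    by (simp_all add: conjugate_def Sym_mult_apply left_mult_def right_mult_def Bij_closed
        Sym_inv_closed Sym_inv_apply autoD(2))
  then show "conjugate S (left_mult L x) \<sigma> = left_mult L (\<sigma> x)"
    and "conjugate S (right_mult L x) \<sigma> = right_mult L (\<sigma> x)"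
    using assms s
    by (auto intro!: extensionalityI[where A = "carrier L"] Bij_imp_extensional
        simp: conjugate_def Sym_mult_closed Sym_inv_closed Bij_closed)
qed

text \<open>Conjugation by \<open>\<sigma>\<close> is compatible with everything from which \<open>p\<^sub>x\<close> is built.\<close>

lemma conjugate_p_map:
  assumes "\<sigma> \<in> auto L" "x \<in> carrier L"
  shows "conjugate S (p_map L x) \<sigma> = p_map L (\<sigma> x)"
  using assms
  by (simp add: p_map_def S.conjugate_mult S.conjugate_inv conjugate_left_mult autoD(1) Sym_inv_closed)

lemma auto_left_nucleus:
  assumes s: "\<sigma> \<in> auto L" and m: "m \<in> carrier L"
  shows "\<sigma> m \<in> left_nucleus L \<longleftrightarrow> m \<in> left_nucleus L"
proof -
  note B = autoD(1)[OF s]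
  have onto: "\<exists>y\<in>carrier L. x = \<sigma> y" if "x \<in> carrier L" for x
    using B that by (auto simp: Bij_def bij_betw_def)
  have inj: "\<sigma> x = \<sigma> y \<longleftrightarrow> x = y" if "x \<in> carrier L" "y \<in> carrier L" for x y
    using B that by (auto simp: Bij_def bij_betw_def inj_on_def)
  have "\<sigma> m \<in> left_nucleus L \<longleftrightarrow> (\<forall>x\<in>carrier L. \<forall>y\<in>carrier L.
      \<sigma> m \<otimes> (\<sigma> x \<otimes> \<sigma> y) = (\<sigma> m \<otimes> \<sigma> x) \<otimes> \<sigma> y)"
    using onto B m unfolding left_nucleus_def by (auto simp: Bij_closed) (metis onto)
  also have "\<dots> \<longleftrightarrow> (\<forall>x\<in>carrier L. \<forall>y\<in>carrier L. \<sigma> (m \<otimes> (x \<otimes> y)) = \<sigma> ((m \<otimes> x) \<otimes> y))"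
    using m by (simp add: autoD(2)[OF s])
  also have "\<dots> \<longleftrightarrow> m \<in> left_nucleus L"
    using m by (simp add: inj left_nucleus_def)
  finally show ?thesis .
qed

lemma Phi_coll:
  assumes "u \<in> Bij (carrier L)" "v \<in> Bij (carrier L)"
  shows "Phi L (coll L u v) = v"
  unfolding Phi_def
  by (rule the_equality) (use assms in \<open>auto simp: coll_eq_iff\<close>)

text \<open>The condition \<open>(\<lambda>\<^sub>x\<lambda>\<^sub>z\<^sup>-\<^sup>1)\<^sup>4 = 1\<close> with \<open>z = x'\<close>, stated by following a point through four steps.
  In this form without inverses its behaviour under collineations is immediate.\<close>

definition periodic :: "'a \<Rightarrow> 'a \<Rightarrow> bool" where
  "periodic x' x \<longleftrightarrow> (\<forall>y0\<in>carrier L. \<forall>y1\<in>carrier L. \<forall>y2\<in>carrier L. \<forall>y3\<in>carrier L. \<forall>y4\<in>carrier L.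
     x' \<otimes> y1 = x \<otimes> y0 \<longrightarrow> x' \<otimes> y2 = x \<otimes> y1 \<longrightarrow> x' \<otimes> y3 = x \<otimes> y2 \<longrightarrow> x' \<otimes> y4 = x \<otimes> y3 \<longrightarrow> y4 = y0)"

lemma periodicD:
  fixes q :: "int \<Rightarrow> 'a"
  assumes "periodic x' x" "\<And>i. q i \<in> carrier L" "\<And>i. x' \<otimes> q (i + 1) = x \<otimes> q i"
  shows "q 4 = q 0"
  using assms(1) assms(2)[of 0] assms(2)[of 1] assms(2)[of 2] assms(2)[of 3] assms(2)[of 4]
    assms(3)[of 0, simplified] assms(3)[of 1, simplified] assms(3)[of 2, simplified]
    assms(3)[of 3, simplified]
  unfolding periodic_def by blast

text \<open>A step \<open>x' \<otimes> z = x \<otimes> y\<close> says that \<open>(x', z)\<close> and \<open>(x, y)\<close> lie on a common transversal line, so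
  collineations carry steps to steps.\<close>

lemma periodic_coll:
  assumes uv: "is_coll u v" and x: "x' \<in> carrier L" "x \<in> carrier L"
    and per: "periodic (u x') (u x)"
  shows "periodic x' x"
  unfolding periodic_def
proof (intro ballI impI)
  note B = is_collD(1,2)[OF uv]
  have step: "u x' \<otimes> v z = u x \<otimes> v y" if "x' \<otimes> z = x \<otimes> y" "y \<in> carrier L" "z \<in> carrier L" for y z
    using is_collD(3)[OF uv x(1) that(3)] is_collD(3)[OF uv x(2) that(2)] that(1) by simp
  fix y0 y1 y2 y3 y4
  assume y: "y0 \<in> carrier L" "y1 \<in> carrier L" "y2 \<in> carrier L" "y3 \<in> carrier L" "y4 \<in> carrier L"
    and "x' \<otimes> y1 = x \<otimes> y0" "x' \<otimes> y2 = x \<otimes> y1" "x' \<otimes> y3 = x \<otimes> y2" "x' \<otimes> y4 = x \<otimes> y3"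
  then have "u x' \<otimes> v y1 = u x \<otimes> v y0" "u x' \<otimes> v y2 = u x \<otimes> v y1"
    "u x' \<otimes> v y3 = u x \<otimes> v y2" "u x' \<otimes> v y4 = u x \<otimes> v y3"
    by (simp_all add: step)
  moreover have "v y0 \<in> carrier L" "v y1 \<in> carrier L" "v y2 \<in> carrier L" "v y3 \<in> carrier L" "v y4 \<in> carrier L"
    using y B by (simp_all add: Bij_closed)
  ultimately have "v y4 = v y0" using per unfolding periodic_def by blast
  then show "y4 = y0" using B(2) y by (auto simp: Bij_def bij_betw_def inj_on_def)
qed

end

section \<open>Collineations of the Bol loops in coordinates\<close>

text \<open>All that matters about \<open>B\<^bsub>4n\<^esub>\<close> and \<open>C\<^bsub>4n\<^esub>\<close> is this multiplication rule.  The truth value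
  \<open>f \<noteq> g\<close> is the sum of \<open>f\<close> and \<open>g\<close> modulo two.\<close>

locale bol_coordinates =
  fixes n h :: int and L :: "('a, 'm) monoid_scheme" (structure) and pt :: "int \<Rightarrow> bool \<Rightarrow> 'a"
  assumes n_gt_2: "n > 2"
    and h_cases: "h = 0 \<or> h = n"
    and even_h: "even h"
    and carrier_eq: "carrier L = {pt k f | k f. True}"
    and pt_eq_iff: "pt k f = pt k' f' \<longleftrightarrow> 2 * n dvd k - k' \<and> f = f'"
    and one_eq: "\<one> = pt 0 False"
    and pt_mult: "pt d g \<otimes> pt k f =
      (if \<not> g \<and> even d then pt (k + d) f else pt (d - k + of_bool f * h) (f \<noteq> g))"
begin

lemma pt_closed [simp, intro]: "pt k f \<in> carrier L"
  by (auto simp: carrier_eq)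

lemma ptE:
  assumes "x \<in> carrier L"
  obtains k f where "x = pt k f"
  using assms by (auto simp: carrier_eq)

text \<open>Coordinate identities hold exactly or up to a shift by \<open>2h\<close>, which is a multiple
  of \<open>2n\<close>.\<close>

lemma pt_eqI:
  assumes "k - k' \<in> {0, 2 * h, - 2 * h}" "f = f'"
  shows "pt k f = pt k' f'"
  using assms h_cases by (auto simp: pt_eq_iff)

text \<open>Maps on the loop given by a formula in the coordinates; the formula must be \<open>2n\<close>-periodic in
  the first coordinate (lemma \<open>on_pts_pt\<close>).\<close>

definition on_pts :: "(int \<Rightarrow> bool \<Rightarrow> 'a) \<Rightarrow> 'a \<Rightarrow> 'a" where
  "on_pts F = (\<lambda>x\<in>carrier L. THE y. \<exists>k f. x = pt k f \<and> y = F k f)"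

lemma on_pts_pt:
  assumes "\<And>k k' f. 2 * n dvd k - k' \<Longrightarrow> F k f = F k' f"
  shows "on_pts F (pt k f) = F k f"
proof -
  have "(THE y. \<exists>k' f'. pt k f = pt k' f' \<and> y = F k' f') = F k f"
  proof (rule the_equality)
    fix y assume "\<exists>k' f'. pt k f = pt k' f' \<and> y = F k' f'"
    then show "y = F k f" using assms by (fastforce simp: pt_eq_iff)
  qed blast
  then show ?thesis by (simp add: on_pts_def)
qed

lemma on_pts_extensional [simp]: "on_pts F \<in> extensional (carrier L)"
  by (simp add: on_pts_def)

lemma eq_on_pts:
  assumes "u \<in> extensional (carrier L)" "v \<in> extensional (carrier L)" "\<And>k f. u (pt k f) = v (pt k f)"
  shows "u = v"
  using assms(1,2) by (rule extensionalityI) (auto elim!: ptE simp: assms(3))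

abbreviation sg :: "bool \<Rightarrow> int" where "sg s \<equiv> (if s then - 1 else 1)"

text \<open>The two components of the collineations below.  The flag \<open>s\<close> marks reflections.  A map \<open>U\<close>
  shifts the left nucleus by \<open>i\<close> and the other points by \<open>j\<close>, after a reflection if \<open>s\<close> holds; a map \<open>V\<close> is the action of
  \<open>\<alpha>\<^sup>k\<gamma>\<^sup>f\<close>, preceded by that of \<open>\<beta>\<close> if \<open>s\<close> holds.\<close>

definition U :: "bool \<Rightarrow> int \<Rightarrow> int \<Rightarrow> 'a \<Rightarrow> 'a" where
  "U s i j = on_pts (\<lambda>d g. if \<not> g \<and> even d then pt (sg s * d + i) g
     else pt (sg s * d + j + of_bool (s \<and> g) * h) g)"

definition V :: "bool \<Rightarrow> int \<Rightarrow> bool \<Rightarrow> 'a \<Rightarrow> 'a" where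
  "V s k f = on_pts (\<lambda>d g. pt (sg s * d + k + of_bool (s \<and> g) * h) (g \<noteq> f))"

lemma U_pt: "U s i j (pt d g) = (if \<not> g \<and> even d then pt (sg s * d + i) g
     else pt (sg s * d + j + of_bool (s \<and> g) * h) g)"
  unfolding U_def
proof (rule on_pts_pt)
  fix k k' :: int and f
  assume *: "2 * n dvd k - k'"
  then have "2 * n dvd k' - k" by (simp add: dvd_diff_commute)
  with * show "(if \<not> f \<and> even k then pt (sg s * k + i) f
     else pt (sg s * k + j + of_bool (s \<and> f) * h) f) =
     (if \<not> f \<and> even k' then pt (sg s * k' + i) f
     else pt (sg s * k' + j + of_bool (s \<and> f) * h) f)"
    using even_iff_if_dvd_diff[OF *] by (simp add: pt_eq_iff)
qed

lemma V_pt: "V s k f (pt d g) = pt (sg s * d + k + of_bool (s \<and> g) * h) (g \<noteq> f)"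
  unfolding V_def
proof (rule on_pts_pt)
  fix d d' :: int and g
  assume *: "2 * n dvd d - d'"
  then have "2 * n dvd d' - d" by (simp add: dvd_diff_commute)
  with * show "pt (sg s * d + k + of_bool (s \<and> g) * h) (g \<noteq> f) =
      pt (sg s * d' + k + of_bool (s \<and> g) * h) (g \<noteq> f)"
    by (simp add: pt_eq_iff)
qed

lemma U_ext [simp]: "U s i j \<in> extensional (carrier L)"
  and V_ext [simp]: "V s k f \<in> extensional (carrier L)"
  by (simp_all add: U_def V_def)

lemma U_Bij:
  assumes "even i" "even j"
  shows "U s i j \<in> Bij (carrier L)"
proof (rule Bij_withI[where v = "U s (- sg s * i) (- sg s * j)"])
  fix x assume "x \<in> carrier L"
  then obtain d g where x: "x = pt d g" by (rule ptE)
  show "U s i j x \<in> carrier L" "U s (- sg s * i) (- sg s * j) x \<in> carrier L"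
    by (simp_all add: x U_pt)
  show "U s (- sg s * i) (- sg s * j) (U s i j x) = x" "U s i j (U s (- sg s * i) (- sg s * j) x) = x"
    using assms even_h by (cases s; cases g; auto simp: x U_pt intro!: pt_eqI)+
qed simp

lemma V_Bij: "V s k f \<in> Bij (carrier L)"
proof (rule Bij_withI[where v = "V s (- sg s * k - of_bool (s \<and> f) * h) f"])
  fix x assume "x \<in> carrier L"
  then obtain d g where x: "x = pt d g" by (rule ptE)
  show "V s k f x \<in> carrier L" "V s (- sg s * k - of_bool (s \<and> f) * h) f x \<in> carrier L"
    by (simp_all add: x V_pt)
  show "V s (- sg s * k - of_bool (s \<and> f) * h) f (V s k f x) = x"
    "V s k f (V s (- sg s * k - of_bool (s \<and> f) * h) f x) = x"
    by (cases s; cases g; cases f; auto simp: x V_pt intro!: pt_eqI)+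
qed simp

lemma left_mult_pt: "left_mult L (pt d g) = V (g \<or> odd d) d g"
  by (rule eq_on_pts) (auto simp: left_mult_def V_pt pt_mult add_ac intro!: pt_eqI)

text \<open>The inverse of \<open>z \<mapsto> z \<otimes> pt e \<phi>\<close> has to find out whether \<open>z\<close> was a rotation or a reflection.
  This is visible in the product: the second coordinate differs from \<open>\<phi>\<close> iff \<open>z\<close> has second
  coordinate \<open>True\<close>, and otherwise the parity of the first coordinate relative to \<open>e\<close> decides.\<close>

lemma right_mult_Bij: "right_mult L (pt e \<phi>) \<in> Bij (carrier L)"
proof -
  let ?F = "\<lambda>k f. if f \<noteq> \<phi> then pt (k + e - of_bool \<phi> * h) True
    else if even (k - e) then pt (k - e) False else pt (k + e - of_bool \<phi> * h) False"
  define v where "v = on_pts ?F"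
  have v: "v (pt k f) = ?F k f" for k f
    unfolding v_def
  proof (rule on_pts_pt)
    fix k k' f assume "2 * n dvd k - k'"
    then show "?F k f = ?F k' f" using even_iff_if_dvd_diff[of n k k'] by (auto simp: pt_eq_iff)
  qed
  show ?thesis
  proof (rule Bij_withI[where v = v])
    fix x assume "x \<in> carrier L"
    then obtain d g where x: "x = pt d g" by (rule ptE)
    show "right_mult L (pt e \<phi>) x \<in> carrier L" "v x \<in> carrier L"
      by (simp_all add: x right_mult_def pt_mult v)
    show "v (right_mult L (pt e \<phi>) x) = x" "right_mult L (pt e \<phi>) (v x) = x"
      using even_h by (auto simp: x right_mult_def pt_mult v intro!: pt_eqI)
  qed (simp add: right_mult_def)
qed

sublocale loop L
proof
  fix x assume x: "x \<in> carrier L"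
  then obtain d g where "x = pt d g" by (rule ptE)
  then show "\<one> \<otimes> x = x" "x \<otimes> \<one> = x"
    "left_mult L x \<in> Bij (carrier L)" "right_mult L x \<in> Bij (carrier L)"
    by (auto simp: one_eq pt_mult left_mult_pt V_Bij right_mult_Bij)
  fix y assume "y \<in> carrier L"
  then show "x \<otimes> y \<in> carrier L"
    using x by (auto elim!: ptE simp: pt_mult)
qed (simp add: one_eq)

lemma U_mult:
  assumes "even i" "even j"
  shows "U s i j \<otimes>\<^bsub>S\<^esub> U s' i' j' = U (s \<noteq> s') (sg s' * i + i') (sg s' * j + j')"
  by (rule eq_on_pts)
    (use assms even_h in \<open>auto simp: Sym_mult_apply U_pt algebra_simps intro!: pt_eqI\<close>,
      simp_all add: Sym_mult)

lemma V_mult: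
  "V s k f \<otimes>\<^bsub>S\<^esub> V s' k' f' = V (s \<noteq> s') (sg s' * k + k' + of_bool (s' \<and> f) * h) (f \<noteq> f')"
  by (rule eq_on_pts)
    (auto simp: Sym_mult_apply V_pt algebra_simps intro!: pt_eqI, simp_all add: Sym_mult)

lemma U_cong:
  assumes "2 * n dvd i - i'" "2 * n dvd j - j'"
  shows "U s i j = U s i' j'"
  by (rule eq_on_pts) (use assms in \<open>auto simp: U_pt pt_eq_iff\<close>)

lemma UV_one: "U False 0 0 = \<one>\<^bsub>S\<^esub>" "V False 0 False = \<one>\<^bsub>S\<^esub>"
  by (rule eq_on_pts; simp add: U_pt V_pt Sym_one)+

section \<open>The group M\<close>

text \<open>The linear conditions on the shifts are those satisfied by the generators of \<open>N\<close> and by the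
  left nuclear translations; they are what the collineation identity needs.  The shift \<open>i\<close> has to
  be even for the left nucleus to be preserved.\<close>

definition K :: "bool \<Rightarrow> int \<Rightarrow> int \<Rightarrow> bool \<Rightarrow> 'a \<times> 'a \<Rightarrow> 'a \<times> 'a" where
  "K s i k f = coll L (U s (i + of_bool f * h) (i + 2 * k)) (V s k f)"

lemma K_Bij:
  assumes "even i"
  shows "U s (i + of_bool f * h) (i + 2 * k) \<in> Bij (carrier L)"
  using assms even_h by (simp add: U_Bij)

lemma K_is_coll:
  assumes i: "even i"
  shows "is_coll (U s (i + of_bool f * h) (i + 2 * k)) (V s k f)" (is "is_coll ?u ?v")
  unfolding is_coll_def
proof (intro conjI ballI K_Bij[OF i] V_Bij)
  fix x y assume "x \<in> carrier L" "y \<in> carrier L"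
  then obtain d g d' g' where xy: "x = pt d g" "y = pt d' g'" by (elim ptE) blast
  show "?u x \<otimes> ?v y = ?u \<one> \<otimes> ?v (x \<otimes> y)"
    using i even_h unfolding xy one_eq
    by (cases s; cases g; cases g'; cases f; cases "even d")
      (auto simp: U_pt V_pt pt_mult algebra_simps intro!: pt_eqI)
qed

lemma K_in_\<Gamma>: "even i \<Longrightarrow> K s i k f \<in> carrier \<Gamma>"
  unfolding K_def by (intro coll_in_\<Gamma> K_is_coll)

lemma K_mult:
  assumes "even i" "even i'"
  shows "K s i k f \<otimes>\<^bsub>\<Gamma>\<^esub> K s' i' k' f' =
    K (s \<noteq> s') (sg s' * i + i') (sg s' * k + k' + of_bool (s' \<and> f) * h) (f \<noteq> f')"
proof -
  have "K s i k f \<otimes>\<^bsub>\<Gamma>\<^esub> K s' i' k' f' =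
    coll L (U (s \<noteq> s') (sg s' * (i + of_bool f * h) + (i' + of_bool f' * h)) 
        (sg s' * (i + 2 * k) + (i' + 2 * k')))
      (V (s \<noteq> s') (sg s' * k + k' + of_bool (s' \<and> f) * h) (f \<noteq> f'))"
    using assms even_h by (simp add: K_def coll_mult_\<Gamma> K_Bij V_Bij U_mult V_mult)
  also have "U (s \<noteq> s') (sg s' * (i + of_bool f * h) + (i' + of_bool f' * h)) 
        (sg s' * (i + 2 * k) + (i' + 2 * k')) =
      U (s \<noteq> s') (sg s' * i + i' + of_bool (f \<noteq> f') * h)
        (sg s' * i + i' + 2 * (sg s' * k + k' + of_bool (s' \<and> f) * h))"
    using h_cases by (intro U_cong) (auto simp: algebra_simps)
  finally show ?thesis by (simp only: K_def)
qed

lemma K_one: "K False 0 0 False = \<one>\<^bsub>\<Gamma>\<^esub>"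
  by (simp add: K_def UV_one coll_one)

lemma K_inv:
  assumes "even i"
  shows "inv\<^bsub>\<Gamma>\<^esub> (K s i k f) = K s (- sg s * i) (- sg s * k + of_bool (s \<and> f) * h) f"
proof (rule \<Gamma>.inv_equality)
  show "K s (- sg s * i) (- sg s * k + of_bool (s \<and> f) * h) f \<otimes>\<^bsub>\<Gamma>\<^esub> K s i k f = \<one>\<^bsub>\<Gamma>\<^esub>"
    using assms by (cases s; cases f) (simp_all add: K_mult K_one)
qed (use assms in \<open>simp_all add: K_in_\<Gamma>\<close>)

definition K_group where "K_group = {K s i k f | s i k f. even i}"

definition M where "M = {K False i k f | i k f. even i}"

lemma K_in_K_group: "even i \<Longrightarrow> K s i k f \<in> K_group"
  and K_in_M: "even i \<Longrightarrow> K False i k f \<in> M"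
  unfolding K_group_def M_def by blast+

lemma K_group_subgroup: "subgroup K_group \<Gamma>"
proof (rule \<Gamma>.subgroupI)
  show "K_group \<subseteq> carrier \<Gamma>" by (auto simp: K_group_def K_in_\<Gamma>)
  show "K_group \<noteq> {}" using K_in_K_group[of 0] by auto
  fix x assume "x \<in> K_group"
  then obtain s i k f where x: "x = K s i k f" "even i" by (auto simp: K_group_def)
  then show "inv\<^bsub>\<Gamma>\<^esub> x \<in> K_group" by (simp add: K_inv K_in_K_group)
  fix y assume "y \<in> K_group"
  then obtain s' i' k' f' where "y = K s' i' k' f'" "even i'" by (auto simp: K_group_def)
  with x show "x \<otimes>\<^bsub>\<Gamma>\<^esub> y \<in> K_group" by (simp add: K_mult K_in_K_group)
qed

lemma M_subgroup: "subgroup M \<Gamma>"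
proof (rule \<Gamma>.subgroupI)
  show "M \<subseteq> carrier \<Gamma>" by (auto simp: M_def K_in_\<Gamma>)
  show "M \<noteq> {}" using K_in_M[of 0] by auto
  fix x assume "x \<in> M"
  then obtain i k f where x: "x = K False i k f" "even i" by (auto simp: M_def)
  then show "inv\<^bsub>\<Gamma>\<^esub> x \<in> M" by (simp add: K_inv K_in_M)
  fix y assume "y \<in> M"
  then obtain i' k' f' where "y = K False i' k' f'" "even i'" by (auto simp: M_def)
  with x show "x \<otimes>\<^bsub>\<Gamma>\<^esub> y \<in> M" by (simp add: K_mult K_in_M)
qed

lemma two_not_dvd: "\<not> 2 * n dvd 2" "\<not> 2 * n dvd 4"
  using n_gt_2 by (auto dest: zdvd_imp_le)

text \<open>For the other elements associativity fails already on the triples with third factor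
  \<open>pt 1 False\<close>: the two products differ by \<open>2\<close> in the first coordinate, up to multiples of \<open>2h\<close>.\<close>

lemma left_nucleus_eq: "left_nucleus L = {pt d False | d. even d}"
proof
  show "{pt d False | d. even d} \<subseteq> left_nucleus L"
    unfolding left_nucleus_def
    by (auto elim!: ptE simp: pt_mult intro!: pt_eqI)
  show "left_nucleus L \<subseteq> {pt d False | d. even d}"
  proof
    fix m assume m: "m \<in> left_nucleus L"
    then obtain d g where dg: "m = pt d g" by (auto simp: left_nucleus_def elim: ptE)
    have assoc: "pt d g \<otimes> (pt k f \<otimes> pt 1 False) = (pt d g \<otimes> pt k f) \<otimes> pt 1 False" for k f
      using m by (simp add: left_nucleus_def dg)
    have "\<not> g" using assoc[of 1 False] two_not_dvd by (auto simp: pt_mult pt_eq_iff)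
    moreover have "even d"
    proof (rule ccontr)
      assume "odd d"
      with \<open>\<not> g\<close> show False
        using assoc[of 0 True] two_not_dvd h_cases by (auto simp: pt_mult pt_eq_iff)
    qed
    ultimately show "m \<in> {pt d False | d. even d}" by (auto simp: dg)
  qed
qed

lemma pt_in_left_nucleus: "pt d f \<in> left_nucleus L \<longleftrightarrow> \<not> f \<and> even d"
proof
  assume "pt d f \<in> left_nucleus L"
  then show "\<not> f \<and> even d" by (auto simp: left_nucleus_eq pt_eq_iff dest: even_iff_if_dvd_diff)
qed (auto simp: left_nucleus_eq)

definition N_gen where "N_gen x = coll L (p_map L x) (left_mult L x)"

text \<open>The inverse of \<open>p\<^sub>x\<close> is the map \<open>z \<mapsto> x \<otimes> (z \<otimes> x)\<close>, which is computed directly.\<close>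

lemma N_gen_pt: "N_gen (pt d f) = K (f \<or> odd d) (if f \<or> odd d then 0 else - 2 * d) d f"
proof -
  let ?u = "U (f \<or> odd d) ((if f \<or> odd d then 0 else - 2 * d) + of_bool f * h)
    ((if f \<or> odd d then 0 else - 2 * d) + 2 * d)"
  have "right_mult L (pt d f) \<otimes>\<^bsub>S\<^esub> left_mult L (pt d f) \<otimes>\<^bsub>S\<^esub> ?u = \<one>\<^bsub>S\<^esub>"
  proof (rule eq_on_pts)
    fix k e
    show "(right_mult L (pt d f) \<otimes>\<^bsub>S\<^esub> left_mult L (pt d f) \<otimes>\<^bsub>S\<^esub> ?u) (pt k e) = \<one>\<^bsub>S\<^esub> (pt k e)"
      using even_h by (cases f; cases e; cases "even d"; cases "even k")
        (auto simp: Sym_mult_apply right_mult_def left_mult_def pt_mult U_pt Sym_one algebra_simps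
          intro!: pt_eqI)
  qed (simp_all add: Sym_mult Sym_one)
  moreover have u: "?u \<in> Bij (carrier L)" using even_h by (intro U_Bij) auto
  ultimately have inv_u: "inv\<^bsub>S\<^esub> ?u = right_mult L (pt d f) \<otimes>\<^bsub>S\<^esub> left_mult L (pt d f)"
    by (intro S.inv_equality) (simp_all add: Sym_mult_closed)
  have "p_map L (pt d f) = inv\<^bsub>S\<^esub> (right_mult L (pt d f) \<otimes>\<^bsub>S\<^esub> left_mult L (pt d f))"
    by (simp add: p_map_def S.inv_mult_group)
  also have "\<dots> = inv\<^bsub>S\<^esub> (inv\<^bsub>S\<^esub> ?u)" by (simp only: inv_u)
  also have "\<dots> = ?u" by (rule S.inv_inv) (simp only: Sym_carrier u)
  finally show ?thesis by (simp only: N_gen_def K_def left_mult_pt)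
qed

lemma N_gen_in_\<Gamma>: "x \<in> carrier L \<Longrightarrow> N_gen x \<in> carrier \<Gamma>"
  by (auto elim!: ptE simp: N_gen_pt K_in_\<Gamma>)

lemma N_group_eq: "N_group L = generate \<Gamma> (N_gen ` carrier L)"
  by (simp add: N_group_def N_gen_def Setcompr_eq_image)

lemma N_subset: "N_group L \<subseteq> K_group"
  unfolding N_group_eq
proof (rule \<Gamma>.generate_subgroup_incl[OF _ K_group_subgroup], clarify)
  fix x assume "x \<in> carrier L"
  then obtain d f where x: "x = pt d f" by (rule ptE)
  show "N_gen x \<in> K_group" unfolding x N_gen_pt by (rule K_in_K_group) simp
qed

lemma T_eq: "T_group L = {K False i 0 False | i. even i}"
proof -
  have "left_mult L (pt i False) = U False i i" if "even i" for i
    by (rule eq_on_pts) (use that in \<open>auto simp: left_mult_pt V_pt U_pt\<close>)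
  moreover have "(\<lambda>y\<in>carrier L. y) = V False 0 False" by (simp add: UV_one Sym_one)
  ultimately have "coll L (left_mult L (pt i False)) (\<lambda>y\<in>carrier L. y) = K False i 0 False" if "even i" for i
    using that by (simp add: K_def)
  then show ?thesis unfolding T_group_def left_nucleus_eq by (force)
qed

text \<open>The rotations \<open>V False k f\<close> are the elements of \<open>\<Lambda>\<^sub>0 = \<langle>\<alpha>, \<gamma>\<rangle>\<close>.\<close>

definition \<Lambda> where
  "\<Lambda> = {f \<in> N_group L. Phi L f \<in> {V False k f | k f. True}}"

text \<open>A reflection \<open>V True k f\<close> and a rotation that agree at \<open>pt 0 False\<close> differ by \<open>2\<close> at
  \<open>pt 1 False\<close>.\<close>

lemma \<Lambda>_subset: "\<Lambda> \<subseteq> M"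
proof
  fix x assume x: "x \<in> \<Lambda>"
  then obtain s i k f where K: "x = K s i k f" "even i" using N_subset by (auto simp: \<Lambda>_def K_group_def)
  then have "Phi L x = V s k f" by (simp add: K_def Phi_coll K_Bij V_Bij)
  with x obtain k' f' where "V s k f = V False k' f'" by (auto simp: \<Lambda>_def)
  then have "V s k f (pt 0 False) = V False k' f' (pt 0 False)"
    "V s k f (pt 1 False) = V False k' f' (pt 1 False)" by simp_all
  then have "\<not> s"
    using two_not_dvd(1) dvd_diff[of "2 * n" "k - k'" "k - k' - 2"]
    by (auto simp: V_pt pt_eq_iff)
  with K show "x \<in> M" by (auto simp: M_def)
qed

text \<open>Two reflections compose to a rotation.  Two on the sheet \<open>True\<close> give all \<open>\<alpha>\<^sup>k\<close>, one on each
  sheet gives all \<open>\<alpha>\<^sup>k\<gamma>\<close>, and the remaining parameter \<open>i\<close> is supplied by \<open>T\<close>.\<close>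

lemma M_factor:
  assumes "x \<in> M"
  shows "\<exists>m\<in>left_nucleus L. \<exists>y\<in>carrier L - left_nucleus L. \<exists>z\<in>carrier L - left_nucleus L.
    x = coll L (left_mult L m) \<one>\<^bsub>S\<^esub> \<otimes>\<^bsub>\<Gamma>\<^esub> (N_gen y \<otimes>\<^bsub>\<Gamma>\<^esub> N_gen z) \<and> N_gen y \<otimes>\<^bsub>\<Gamma>\<^esub> N_gen z \<in> \<Lambda>"
proof -
  obtain i k f where x: "x = K False i k f" "even i" using assms by (auto simp: M_def)
  have K_gg: "\<exists>y\<in>carrier L - left_nucleus L. \<exists>z\<in>carrier L - left_nucleus L.
      K False 0 k f = N_gen y \<otimes>\<^bsub>\<Gamma>\<^esub> N_gen z"
  proof (cases f)
    case True
    have "N_gen (pt 1 False) \<otimes>\<^bsub>\<Gamma>\<^esub> N_gen (pt (k + 1) True) = K False 0 k f"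
      by (simp add: N_gen_pt K_mult True)
    moreover have "pt 1 False \<in> carrier L - left_nucleus L" "pt (k + 1) True \<in> carrier L - left_nucleus L"
      by (simp_all add: pt_in_left_nucleus)
    ultimately show ?thesis by metis
  next
    case False
    have "N_gen (pt 0 True) \<otimes>\<^bsub>\<Gamma>\<^esub> N_gen (pt (k - h) True) = K False 0 k f"
      by (simp add: N_gen_pt K_mult False)
    moreover have "pt 0 True \<in> carrier L - left_nucleus L" "pt (k - h) True \<in> carrier L - left_nucleus L"
      by (simp_all add: pt_in_left_nucleus)
    ultimately show ?thesis by metis
  qed
  then obtain y z where yz: "y \<in> carrier L - left_nucleus L" "z \<in> carrier L - left_nucleus L"
    "K False 0 k f = N_gen y \<otimes>\<^bsub>\<Gamma>\<^esub> N_gen z" by blast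
  have "N_gen y \<otimes>\<^bsub>\<Gamma>\<^esub> N_gen z \<in> N_group L"
    using yz(1,2) by (auto simp: N_group_eq intro: generate.eng generate.incl)
  moreover have "Phi L (K False 0 k f) = V False k f"
    unfolding K_def by (intro Phi_coll K_Bij V_Bij) simp
  ultimately have "N_gen y \<otimes>\<^bsub>\<Gamma>\<^esub> N_gen z \<in> \<Lambda>" by (auto simp: \<Lambda>_def yz(3))
  moreover have "x = K False i 0 False \<otimes>\<^bsub>\<Gamma>\<^esub> K False 0 k f"
    using x by (simp add: K_mult)
  moreover obtain m where "m \<in> left_nucleus L" "K False i 0 False = coll L (left_mult L m) \<one>\<^bsub>S\<^esub>"
  proof -
    have "K False i 0 False \<in> T_group L" using x(2) by (auto simp: T_eq)
    with that show ?thesis by (auto simp: T_group_def Sym_one)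
  qed
  ultimately show ?thesis using yz by metis
qed

lemma M_eq: "T_group L <#>\<^bsub>\<Gamma>\<^esub> \<Lambda> = M"
proof
  interpret M: subgroup M \<Gamma> by (rule M_subgroup)
  have T: "T_group L \<subseteq> M" by (auto simp: T_eq K_in_M)
  show "T_group L <#>\<^bsub>\<Gamma>\<^esub> \<Lambda> \<subseteq> M"
    using T \<Lambda>_subset by (auto simp: set_mult_def)
  show "M \<subseteq> T_group L <#>\<^bsub>\<Gamma>\<^esub> \<Lambda>"
  proof
    fix x assume "x \<in> M"
    then obtain m y where "m \<in> left_nucleus L" "y \<in> \<Lambda>"
      "x = coll L (left_mult L m) \<one>\<^bsub>S\<^esub> \<otimes>\<^bsub>\<Gamma>\<^esub> y"
      using M_factor by blast
    then show "x \<in> T_group L <#>\<^bsub>\<Gamma>\<^esub> \<Lambda>"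
      unfolding set_mult_def T_group_def Sym_one by blast
  qed
qed

lemma N_gen_mult_in_M:
  assumes "y \<in> carrier L - left_nucleus L" "z \<in> carrier L - left_nucleus L"
  shows "N_gen y \<otimes>\<^bsub>\<Gamma>\<^esub> N_gen z \<in> M"
proof -
  obtain d f d' f' where "y = pt d f" "z = pt d' f'"
    using assms by (auto elim!: ptE)
  moreover from this have "f \<or> odd d" "f' \<or> odd d'"
    using assms by (auto simp: pt_in_left_nucleus)
  ultimately show ?thesis by (simp add: N_gen_pt K_mult K_in_M)
qed

lemma conjugate_N_gen:
  assumes "\<sigma> \<in> auto L" "x \<in> carrier L"
  shows "conjugate \<Gamma> (N_gen x) (coll L \<sigma> \<sigma>) = N_gen (\<sigma> x)"
proof -
  have "p_map L x \<in> Bij (carrier L)"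
    using assms(2) by (simp add: p_map_def Sym_mult_closed Sym_inv_closed)
  then show ?thesis
    using assms by (simp add: N_gen_def conjugate_coll conjugate_p_map conjugate_left_mult)
qed

text \<open>Automorphisms preserve the left nucleus and its complement, so they carry a factorization as
  in \<open>M_factor\<close> to another one.\<close>

lemma conjugate_M:
  assumes s: "\<sigma> \<in> auto L" and x: "x \<in> M"
  shows "conjugate \<Gamma> x (coll L \<sigma> \<sigma>) \<in> M"
proof -
  let ?s = "coll L \<sigma> \<sigma>"
  have s_in: "?s \<in> carrier \<Gamma>" using s by (simp add: coll_in_\<Gamma> auto_is_coll)
  have closed: "\<sigma> y \<in> carrier L" if "y \<in> carrier L" for y
    using that autoD(1)[OF s] by (simp add: Bij_closed)
  obtain m y z where m: "m \<in> left_nucleus L"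
    and yz: "y \<in> carrier L - left_nucleus L" "z \<in> carrier L - left_nucleus L"
    and x_eq: "x = coll L (left_mult L m) \<one>\<^bsub>S\<^esub> \<otimes>\<^bsub>\<Gamma>\<^esub> (N_gen y \<otimes>\<^bsub>\<Gamma>\<^esub> N_gen z)"
    using M_factor[OF x] by blast
  have m': "m \<in> carrier L" using m by (simp add: left_nucleus_def)
  have T_M: "coll L (left_mult L m) \<one>\<^bsub>S\<^esub> \<in> M" if "m \<in> left_nucleus L" for m
  proof -
    have "coll L (left_mult L m) \<one>\<^bsub>S\<^esub> \<in> T_group L" using that by (auto simp: T_group_def Sym_one)
    then show ?thesis by (auto simp: T_eq K_in_M)
  qed
  have "conjugate \<Gamma> (coll L (left_mult L m) \<one>\<^bsub>S\<^esub>) ?s = coll L (left_mult L (\<sigma> m)) \<one>\<^bsub>S\<^esub>"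
  proof -
    have "conjugate S \<one>\<^bsub>S\<^esub> \<sigma> = \<one>\<^bsub>S\<^esub>" using autoD(1)[OF s] by (simp add: conjugate_def Sym_inv_closed)
    then show ?thesis
      using s m' S.one_closed by (simp add: conjugate_coll conjugate_left_mult)
  qed
  moreover have "coll L (left_mult L m) \<one>\<^bsub>S\<^esub> \<in> carrier \<Gamma>"
    using T_M[OF m] subgroup.mem_carrier[OF M_subgroup] by blast
  ultimately have "conjugate \<Gamma> x ?s =
      coll L (left_mult L (\<sigma> m)) \<one>\<^bsub>S\<^esub> \<otimes>\<^bsub>\<Gamma>\<^esub> (N_gen (\<sigma> y) \<otimes>\<^bsub>\<Gamma>\<^esub> N_gen (\<sigma> z))"
    using yz s s_in by (simp add: x_eq \<Gamma>.conjugate_mult N_gen_in_\<Gamma> conjugate_N_gen)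
  moreover have "\<sigma> m \<in> left_nucleus L" "\<sigma> y \<in> carrier L - left_nucleus L"
      "\<sigma> z \<in> carrier L - left_nucleus L"
    using m m' yz closed auto_left_nucleus[OF s] by auto
  ultimately show ?thesis
    using T_M N_gen_mult_in_M subgroup.m_closed[OF M_subgroup] by simp
qed

section \<open>The orbit of the point (1, 1)\<close>

lemma finite_carrier: "finite (carrier L)"
proof -
  have "carrier L \<subseteq> (\<lambda>(k, f). pt k f) ` ({0..<2 * n} \<times> UNIV)"
  proof
    fix x assume "x \<in> carrier L"
    then obtain k f where "x = pt k f" by (rule ptE)
    then have "x = pt (k mod (2 * n)) f" by (simp add: pt_eq_iff minus_mod_eq_mult_div)
    moreover have "k mod (2 * n) \<in> {0..<2 * n}" using n_gt_2 by simp
    ultimately show "x \<in> (\<lambda>(k, f). pt k f) ` ({0..<2 * n} \<times> UNIV)" by auto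
  qed
  then show ?thesis by (rule finite_subset) simp
qed

text \<open>Reflections have order two or, on the sheet \<open>True\<close> with \<open>h = n\<close>, order four.\<close>

lemma not_periodic_one:
  assumes "\<not> periodic \<one> (pt d f)"
  shows "\<not> f \<and> even d \<and> \<not> 2 * n dvd 4 * d"
proof -
  define x where "x = pt d f"
  have 4: "x \<otimes> (x \<otimes> (x \<otimes> (x \<otimes> y))) = y"
    if y: "y \<in> carrier L" and "f \<or> odd d \<or> 2 * n dvd 4 * d" for y
  proof -
    obtain k e where y: "y = pt k e" using y by (rule ptE)
    show ?thesis
    proof (cases "f \<or> odd d")
      case True
      then show ?thesis unfolding y x_def by (cases e; cases f) (auto simp: pt_mult intro!: pt_eqI)
    next
      case False
      then show ?thesis using that(2) unfolding y x_def by (auto simp: pt_mult pt_eq_iff)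
    qed
  qed
  have "\<not> (f \<or> odd d \<or> 2 * n dvd 4 * d)"
  proof
    assume "f \<or> odd d \<or> 2 * n dvd 4 * d"
    then have "periodic \<one> x"
      using 4 unfolding periodic_def by (auto simp: x_def)
    with assms show False by (simp add: x_def)
  qed
  then show ?thesis by simp
qed

text \<open>For two reflections of the same kind, a step is the rotation \<open>k \<mapsto> k - d\<close>.\<close>

lemma nonperiodic_translate:
  assumes d: "even d" "\<not> 2 * n dvd 4 * d" and e: "\<phi> \<or> odd e"
  shows "\<not> periodic (pt e \<phi>) (pt (e + d) \<phi>)"
proof
  assume per: "periodic (pt e \<phi>) (pt (e + d) \<phi>)"
  have "pt (- (4 * d)) False = pt (- (0 * d)) False"
    by (rule periodicD[OF per, where q = "\<lambda>i. pt (- (i * d)) False"])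
      (use d e in \<open>auto simp: pt_mult algebra_simps intro!: pt_eqI\<close>)
  with d show False by (simp add: pt_eq_iff)
qed

text \<open>A further nonperiodic pair, at the odd distance \<open>1\<close>.  If \<open>pt e \<phi>\<close> lies on the sheet \<open>False\<close>,
  the step also changes the sheet and shifts by \<open>h\<close>.\<close>

lemma nonperiodic_extra:
  assumes e: "\<phi> \<or> odd e"
  shows "\<not> periodic (pt e \<phi>) (pt (e + 1) True)"
proof
  assume per: "periodic (pt e \<phi>) (pt (e + 1) True)"
  \<comment> \<open>the orbit of \<open>pt 0 False\<close>: after four steps the shift is \<open>- 4\<close> or \<open>4 * (h - 1)\<close>\<close>
  let ?q = "\<lambda>i :: int. pt (if \<phi> then - i else i * (h - 1)) (\<not> \<phi> \<and> odd i)"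
  have step: "pt e \<phi> \<otimes> ?q (i + 1) = pt (e + 1) True \<otimes> ?q i" for i
  proof (cases "\<phi>")
    case True
    then show ?thesis by (auto simp: pt_mult intro!: pt_eqI)
  next
    case False
    then show ?thesis using e by (auto simp: pt_mult algebra_simps intro!: pt_eqI)
  qed
  have "?q 4 = ?q 0"
    by (rule periodicD[OF per, where q = ?q]) (use step in simp_all)
  then have "2 * n dvd 4"
    using h_cases dvd_diff[of "2 * n" "4 * n" "4 * n - 4"]
    by (auto simp: pt_eq_iff split: if_splits)
  then show False using two_not_dvd by simp
qed

text \<open>Let \<open>D z\<close> be the set of all \<open>x\<close> that are not periodic relative to \<open>z\<close>.  On the one hand \<open>u\<close>
  embeds \<open>D x'\<close> into \<open>D \<one>\<close>.  On the other hand, if \<open>x'\<close> were outside the left nucleus, right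
  multiplication by \<open>x'\<close> would embed \<open>D \<one>\<close> into \<open>D x'\<close> and miss the point of
  \<open>nonperiodic_extra\<close>.\<close>

lemma coll_to_unit:
  assumes uv: "is_coll u v" and x': "x' \<in> carrier L" and unit: "u x' = \<one>"
  shows "x' \<in> left_nucleus L"
proof (rule ccontr)
  assume nuc: "x' \<notin> left_nucleus L"
  obtain e \<phi> where e: "x' = pt e \<phi>" using x' by (rule ptE)
  with nuc have e_refl: "\<phi> \<or> odd e" by (auto simp: pt_in_left_nucleus)
  define D where "D z = {x \<in> carrier L. \<not> periodic z x}" for z
  have fin: "finite (D z)" for z by (simp add: D_def finite_carrier)
  note B = is_collD(1,2)[OF uv]
  have "card (D x') \<le> card (D \<one>)"
  proof (rule card_inj_on_le[of u])
    show "inj_on u (D x')"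
      using B(1) by (auto simp: D_def Bij_def bij_betw_def intro: inj_on_subset)
    show "u ` D x' \<subseteq> D \<one>"
      using periodic_coll[OF uv x'] B(1) by (auto simp: D_def unit Bij_closed)
  qed (rule fin)
  moreover have "card (D \<one>) < card (D x')"
  proof -
    let ?\<rho> = "right_mult L x'"
    have D_one: "\<exists>d. x = pt d False \<and> even d \<and> \<not> 2 * n dvd 4 * d" if x: "x \<in> D \<one>" for x
    proof -
      obtain d f where "x = pt d f" using x by (auto simp: D_def elim: ptE)
      then show ?thesis using x not_periodic_one[of d f] by (auto simp: D_def)
    qed
    have image: "?\<rho> ` D \<one> \<subseteq> D x' - {pt (e + 1) True}"
    proof (rule image_subsetI)
      fix x assume "x \<in> D \<one>"
      then obtain d where d: "x = pt d False" "even d" "\<not> 2 * n dvd 4 * d" using D_one by blast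
      then have "?\<rho> x = pt (e + d) \<phi>" by (simp add: right_mult_def pt_mult e)
      moreover have "\<not> 2 * n dvd d - 1" using d(2) even_iff_if_dvd_diff[of n d 1] by auto
      ultimately show "?\<rho> x \<in> D x' - {pt (e + 1) True}"
        using nonperiodic_translate[OF d(2,3) e_refl] by (simp add: D_def e pt_eq_iff)
    qed
    have "inj_on ?\<rho> (D \<one>)"
      using right_mult_Bij[OF x'] by (auto simp: D_def Bij_def bij_betw_def intro: inj_on_subset)
    then have "card (D \<one>) \<le> card (D x' - {pt (e + 1) True})"
      using image fin by (intro card_inj_on_le) auto
    also have "\<dots> < card (D x')"
      using fin nonperiodic_extra[OF e_refl] by (intro card_Diff1_less) (auto simp: D_def e)
    finally show ?thesis .
  qed
  ultimately show False by simp
qed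

text \<open>The inverse of \<open>(u, v)\<close> maps \<open>u \<one>\<close> to \<open>\<one>\<close>, so \<open>u \<one>\<close> lies in the left nucleus.\<close>

lemma \<Gamma>_orbit:
  assumes "f \<in> carrier \<Gamma>"
  shows "\<exists>m\<in>M. m (\<one>, \<one>) = f (\<one>, \<one>)"
proof -
  obtain u v where f: "f = coll L u v" and uv: "is_coll u v"
    using assms by (auto simp: \<Gamma>_carrier)
  note B = is_collD(1,2)[OF uv]
  have "u \<one> \<in> left_nucleus L"
    using coll_to_unit[OF is_coll_inv[OF uv], of "u \<one>"] B by (simp add: Bij_closed Sym_inv_apply)
  then obtain d where d: "u \<one> = pt d False" "even d" by (auto simp: left_nucleus_eq)
  obtain k f' where v: "v \<one> = pt k f'" using Bij_closed[OF B(2) unit_closed] by (rule ptE)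
  \<comment> \<open>\<open>K\<close> shifts the left nucleus by its parameter plus \<open>of_bool f' * h\<close>; the total has to be \<open>d\<close>.\<close>
  have "K False (d - of_bool f' * h) k f' (\<one>, \<one>) = (pt d False, pt k f')"
    unfolding K_def coll_apply[OF unit_closed unit_closed] by (simp add: one_eq U_pt V_pt)
  also have "\<dots> = f (\<one>, \<one>)" by (simp add: f coll_apply d v)
  finally have "K False (d - of_bool f' * h) k f' (\<one>, \<one>) = f (\<one>, \<one>)" .
  moreover have "K False (d - of_bool f' * h) k f' \<in> M"
    using d even_h by (intro K_in_M) simp
  ultimately show ?thesis by blast
qed

lemma M_free:
  assumes "m \<in> M" "m (\<one>, \<one>) = (\<one>, \<one>)"
  shows "m = \<one>\<^bsub>\<Gamma>\<^esub>"
proof -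
  obtain i k f where m: "m = K False i k f" "even i" using assms(1) by (auto simp: M_def)
  then have "2 * n dvd i" "2 * n dvd k" "\<not> f"
    using assms(2) by (auto simp: K_def coll_apply one_eq U_pt V_pt pt_eq_iff)
  then have "U False (i + of_bool f * h) (i + 2 * k) = \<one>\<^bsub>S\<^esub>" "V False k f = \<one>\<^bsub>S\<^esub>"
    by (auto intro!: eq_on_pts simp: U_pt V_pt Sym_one pt_eq_iff)
  then show ?thesis by (simp add: m(1) K_def coll_one)
qed

theorem semidirect_product: "is_semidirect_product \<Gamma> M Aut_colls"
proof (rule semidirect_product_if_regular_orbit)
  show "subgroup M \<Gamma>" by (rule M_subgroup)
  show "\<exists>m\<in>M. m (\<one>, \<one>) = f (\<one>, \<one>)" if "f \<in> carrier \<Gamma>" for f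
    using that by (rule \<Gamma>_orbit)
  show "m = \<one>\<^bsub>\<Gamma>\<^esub>" if "m \<in> M" "m (\<one>, \<one>) = (\<one>, \<one>)" for m
    using that by (rule M_free)
next
  interpret Aut_colls: subgroup Aut_colls \<Gamma> by (rule subgroup_Aut_colls)
  fix s m assume s: "s \<in> Aut_colls" and m: "m \<in> M"
  obtain \<sigma> where \<sigma>: "\<sigma> \<in> auto L" "inv\<^bsub>\<Gamma>\<^esub> s = coll L \<sigma> \<sigma>"
    using Aut_colls.m_inv_closed[OF s] unfolding Aut_colls_def by blast
  have "s \<otimes>\<^bsub>\<Gamma>\<^esub> m \<otimes>\<^bsub>\<Gamma>\<^esub> inv\<^bsub>\<Gamma>\<^esub> s = conjugate \<Gamma> m (inv\<^bsub>\<Gamma>\<^esub> s)"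
    using s by (simp add: conjugate_def)
  then show "s \<otimes>\<^bsub>\<Gamma>\<^esub> m \<otimes>\<^bsub>\<Gamma>\<^esub> inv\<^bsub>\<Gamma>\<^esub> s \<in> M"
    using conjugate_M[OF \<sigma>(1) m] \<sigma>(2) by simp
qed

end

section \<open>The collineation group\<close>

context bol_presentation begin

lemma coordinates: "bol_coordinates (int n) (int h) (bol_loop n R) pt"
  by unfold_locales
    (use n_gt_2 h_cases even_h in \<open>simp_all add: bol_loop_carrier bol_loop_one bol_loop_mult pt_eq_iff\<close>)

text \<open>The action of \<open>\<alpha>\<^sup>k\<gamma>\<^sup>f\<close> on the cosets is the coordinate translation \<open>V False k f\<close>.\<close>

lemma M_group_coordinates:
  "M_group n R = bol_coordinates.M (int h) (bol_loop n R) pt"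
proof -
  interpret C: bol_coordinates "int n" "int h" "bol_loop n R" pt by (rule coordinates)
  have "C.V False k f = (\<lambda>X\<in>carrier (bol_loop n R). X #>\<^bsub>G\<^esub> (a [^]\<^bsub>G\<^esub> k \<otimes>\<^bsub>G\<^esub> c_pow f))" for k f
    by (rule C.eq_on_pts) (simp_all add: C.V_pt pt_translate)
  then have "Lambda_group n R = C.\<Lambda>"
    by (simp add: Lambda_group_def C.\<Lambda>_def Lambda0_eq)
  then show ?thesis
    by (simp add: M_group_def flip: C.M_eq)
qed

lemma collineation_group_structure:
  defines "L \<equiv> bol_loop n R"
  defines "\<Gamma> \<equiv> collineation_group L"
  shows "(\<lambda>\<sigma>. coll L \<sigma> \<sigma>) \<in> hom (Aut L) \<Gamma>
    \<and> inj_on (\<lambda>\<sigma>. coll L \<sigma> \<sigma>) (carrier (Aut L))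
    \<and> is_semidirect_product \<Gamma> (M_group n R) ((\<lambda>\<sigma>. coll L \<sigma> \<sigma>) ` carrier (Aut L))
    \<and> (\<forall>\<sigma>\<in>carrier (Aut L). \<forall>u\<in>Bij (carrier L). \<forall>v\<in>Bij (carrier L).
         coll L u v \<in> M_group n R \<longrightarrow>
         conjugate \<Gamma> (coll L u v) (coll L \<sigma> \<sigma>) =
           coll L (conjugate (Sym (carrier L)) u \<sigma>) (conjugate (Sym (carrier L)) v \<sigma>))"
proof -
  interpret C: bol_coordinates "int n" "int h" L pt unfolding L_def by (rule coordinates)
  have "carrier (Aut L) = auto L" by (simp add: Aut_def)
  then show ?thesis
    using C.Aut_embedding C.semidirect_product
    by (simp add: \<Gamma>_def M_group_coordinates C.conjugate_coll flip: L_def)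
qed

end

theorem theorem6p2:
  fixes n :: nat
    and R :: "(abc_word \<times> abc_word) set"
    and L :: "abc_word set set monoid"
    and \<Gamma> :: "(abc_word set set \<times> abc_word set set \<Rightarrow> abc_word set set \<times> abc_word set set) monoid"
  assumes "n > 2"
    and "R = G_relations n \<or> (even n \<and> R = H_relations n)"
    and "L = bol_loop n R"
    and "\<Gamma> = collineation_group L"
  shows "(\<lambda>\<sigma>. coll L \<sigma> \<sigma>) \<in> hom (Aut L) \<Gamma>
    \<and> inj_on (\<lambda>\<sigma>. coll L \<sigma> \<sigma>) (carrier (Aut L))
    \<and> is_semidirect_product \<Gamma> (M_group n R) ((\<lambda>\<sigma>. coll L \<sigma> \<sigma>) ` carrier (Aut L))
    \<and> (\<forall>\<sigma>\<in>carrier (Aut L). \<forall>u\<in>Bij (carrier L). \<forall>v\<in>Bij (carrier L).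
         coll L u v \<in> M_group n R \<longrightarrow>
         conjugate \<Gamma> (coll L u v) (coll L \<sigma> \<sigma>) =
           coll L (conjugate (Sym (carrier L)) u \<sigma>) (conjugate (Sym (carrier L)) v \<sigma>))"
proof -
  have "bol_presentation n (if R = G_relations n then 0 else n) R"
    using assms(1,2) by unfold_locales (auto simp: G_relations_def H_relations_def)
  then show ?thesis
    unfolding assms(3,4) by (rule bol_presentation.collineation_group_structure)
qed

end
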